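(* Let $n\ge 2$ and $p>n$, let $x_1,\dots,x_N\in\mathbb{R}^n$ be distinct and $a_1,\dots,a_N\in\mathbb{R}$. Suppose $u\in \mathcal{D}^{1,p}(\mathbb{R}^n)$ minimizes $$\int_{\mathbb{R}^n}|Dv|^pdx$$ among all $v\in\mathcal{D}^{1,p}(\mathbb{R}^n)$ satisfying $v(x_j)=a_j$ for $j=1,\dots,N$, and let $i\in\{1,\dots,N\}$. If $u$ has a strict local maximum or minimum at $x_i$, then $u$ is not differentiable at $x_i$.
   Context: $\mathcal{D}^{1,p}(\mathbb{R}^n)=\{u\in L^1_{\mathrm{loc}}(\mathbb{R}^n): u_{x_i}\in L^p(\mathbb{R}^n)\text{ for } i=1,\dots,n\}$ (weak derivatives). Since $p>n$, each element is identified with its continuous representative, so point values are meaningful. *)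

theory Defs
  imports "HOL-Analysis.Analysis"
begin

definition partial :: "'n::finite \<Rightarrow> (real^'n \<Rightarrow> real) \<Rightarrow> real^'n \<Rightarrow> real" where
  "partial i f x = frechet_derivative f (at x) (axis i 1)"

text \<open>In the successor case the partial derivatives are required to be \<open>C^k\<close>, hence continuous.\<close>

primrec C_k :: "nat \<Rightarrow> (real^'n::finite \<Rightarrow> real) \<Rightarrow> bool" where
  "C_k 0 f \<longleftrightarrow> continuous_on UNIV f"
| "C_k (Suc k) f \<longleftrightarrow> (\<forall>x. f differentiable (at x)) \<and> (\<forall>i. C_k k (partial i f))"

definition test_function :: "(real^'n::finite \<Rightarrow> real) \<Rightarrow> bool" where
  "test_function \<phi> \<longleftrightarrow> (\<forall>k. C_k k \<phi>) \<and> compact (closure {x. \<phi> x \<noteq> 0})"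

definition L1_loc :: "(real^'n::finite \<Rightarrow> real) set" where
  "L1_loc = {f. \<forall>K. compact K \<longrightarrow> f absolutely_integrable_on K}"

definition Lp :: "real \<Rightarrow> (real^'n::finite \<Rightarrow> real) set" where
  "Lp p = {f \<in> borel_measurable lebesgue. integrable lebesgue (\<lambda>x. \<bar>f x\<bar> powr p)}"

definition has_weak_partial ::
  "'n::finite \<Rightarrow> (real^'n \<Rightarrow> real) \<Rightarrow> (real^'n \<Rightarrow> real) \<Rightarrow> bool" where
  "has_weak_partial i u g \<longleftrightarrow> u \<in> L1_loc \<and> g \<in> L1_loc \<and>
     (\<forall>\<phi>. test_function \<phi> \<longrightarrow>
        (\<integral>x. u x * partial i \<phi> x \<partial>lebesgue) = - (\<integral>x. g x * \<phi> x \<partial>lebesgue))"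

definition D1p :: "real \<Rightarrow> (real^'n::finite \<Rightarrow> real) set" where
  "D1p p = {u \<in> L1_loc. \<forall>i. \<exists>g \<in> Lp p. has_weak_partial i u g}"

text \<open>For \<open>p > n\<close> every almost-everywhere class in \<open>D1p p\<close> has exactly one continuous
  representative; \<open>D1p_cont p\<close> consists of these representatives.\<close>

definition D1p_cont :: "real \<Rightarrow> (real^'n::finite \<Rightarrow> real) set" where
  "D1p_cont p = {u \<in> D1p p. continuous_on UNIV u}"

text \<open>Weak partial derivatives are unique only up to null sets. The choice made here is
  immaterial for the energy below, and is meaningful only if a weak derivative exists.\<close>

definition weak_gradient :: "(real^'n::finite \<Rightarrow> real) \<Rightarrow> real^'n \<Rightarrow> real^'n" where
  "weak_gradient u x = (\<chi> i. (SOME g. has_weak_partial i u g) x)"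

definition energy :: "real \<Rightarrow> (real^'n::finite \<Rightarrow> real) \<Rightarrow> real" where
  "energy p u = (\<integral>x. norm (weak_gradient u x) powr p \<partial>lebesgue)"

definition strict_local_max_at :: "(real^'n::finite \<Rightarrow> real) \<Rightarrow> real^'n \<Rightarrow> bool" where
  "strict_local_max_at u z \<longleftrightarrow> (\<exists>r>0. \<forall>y. 0 < dist y z \<and> dist y z < r \<longrightarrow> u y < u z)"

definition strict_local_min_at :: "(real^'n::finite \<Rightarrow> real) \<Rightarrow> real^'n \<Rightarrow> bool" where
  "strict_local_min_at u z \<longleftrightarrow> (\<exists>r>0. \<forall>y. 0 < dist y z \<and> dist y z < r \<longrightarrow> u y > u z)"

end

theory Submission
  imports Defs
begin

text \<open>
  After replacing \<open>u\<close> by \<open>- u\<close> if necessary, let \<open>z\<close> be a strict local maximum and \<open>M = u z\<close>. Suppose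
  \<open>M - u x \<le> K |x - z|\<close> near \<open>z\<close>; differentiability is used only in this form. For small \<open>s > 0\<close> truncate
  \<open>u\<close> near \<open>z\<close> to \<open>w\<^sub>s = (u - M + s)\<^sub>+\<^sup>2 / 2s\<close>, so that \<open>D w\<^sub>s = \<kappa>\<^sub>s D u\<close> with \<open>0 \<le> \<kappa>\<^sub>s \<le> 1\<close>, and
  compare \<open>u\<close> with \<open>u - t (w\<^sub>s - (s/2) \<zeta>\<^sub>\<rho>)\<close>, where the bump \<open>\<zeta>\<^sub>\<rho>\<close> of width \<open>\<rho>\<close> restores the value at \<open>z\<close>.
  Taking \<open>t = 1\<close> and \<open>s = 2 K \<rho>\<close>, convexity gives \<open>\<integral>\<^bsub>B(z,\<rho>)\<^esub> |Du|\<^sup>p \<le> C \<rho>\<^sup>n\<close>. Taking then \<open>t = \<rho>\<close> and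
  \<open>s\<close> fixed gives \<open>\<rho> \<integral> \<kappa>\<^sub>s |Du|\<^sup>p \<le> C \<rho>\<^sup>n\<close>. As \<open>n \<ge> 2\<close>, letting \<open>\<rho> \<longrightarrow> 0\<close> shows \<open>D w\<^sub>s = 0\<close>, which is
  absurd because \<open>w\<^sub>s\<close> is continuous with compact support and \<open>w\<^sub>s z = s/2\<close>.

  The chain rule for \<open>D w\<^sub>s\<close> needs no mollification: the difference quotients of \<open>u\<close> converge to the weak
  derivative when tested against continuous functions of compact support, and these are uniform limits
  of test functions by the Stone-Weierstrass theorem.
\<close>

subsection \<open>Smooth functions\<close>

definition smooth :: "(real^'n::finite \<Rightarrow> real) \<Rightarrow> bool" where
  "smooth f \<longleftrightarrow> (\<forall>k. C_k k f)"

lemma smooth_differentiable: "smooth f \<Longrightarrow> f differentiable (at x)"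
  unfolding smooth_def using C_k.simps(2)[of 0] by blast

lemma smooth_partial: "smooth f \<Longrightarrow> smooth (partial i f)"
  unfolding smooth_def using C_k.simps(2) by blast

lemma smooth_continuous: "smooth f \<Longrightarrow> continuous_on A f"
  using smooth_def C_k.simps(1) continuous_on_subset by blast

text \<open>Induction on \<open>k\<close> with \<open>f\<close> arbitrary: a member of
  \<open>S\<close> is differentiable, hence continuous, and its partial derivatives are again
  members, so each order reduces to the previous one for another member.\<close>

lemma smooth_coinduct:
  assumes "f \<in> S" and "\<And>f x. f \<in> S \<Longrightarrow> f differentiable (at x)"
    and "\<And>f i. f \<in> S \<Longrightarrow> partial i f \<in> S"
  shows "smooth f"
proof -
  have "C_k k f" if "f \<in> S" for k f
    using that
  proof (induction k arbitrary: f)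
    case 0
    then show ?case
      using assms(2) by (simp add: continuous_at_imp_continuous_on differentiable_imp_continuous_within)
  next
    case (Suc k)
    then show ?case using assms by auto
  qed
  then show ?thesis using assms(1) smooth_def by blast
qed

lemma partial_eq: "(f has_derivative D) (at x) \<Longrightarrow> partial i f x = D (axis i 1)"
  by (simp add: frechet_derivative_at[symmetric] partial_def)

text \<open>A set of one-variable functions closed under differentiation. The whole set is the
  parameter because the chain rule turns \<open>\<eta>\<close> into \<open>\<eta>'\<close>, which
  must again be an admissible outer function.\<close>

definition smooth_real :: "(real \<Rightarrow> real) set \<Rightarrow> bool" where
  "smooth_real S \<longleftrightarrow> (\<forall>f\<in>S. \<exists>f'\<in>S. \<forall>x. (f has_real_derivative f' x) (at x))"

text \<open>Closure under partial derivatives makes all members smooth by coinduction, which avoids a Leibniz or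
  Faa di Bruno formula for each operation.\<close>

inductive_set smooth_gen :: "(real \<Rightarrow> real) set \<Rightarrow> (real^'n::finite \<Rightarrow> real) set"
  for S :: "(real \<Rightarrow> real) set" where
  base: "smooth f \<Longrightarrow> f \<in> smooth_gen S"
| const: "(\<lambda>x. c) \<in> smooth_gen S"
| coord: "(\<lambda>x. x $ i) \<in> smooth_gen S"
| add: "f \<in> smooth_gen S \<Longrightarrow> g \<in> smooth_gen S \<Longrightarrow> (\<lambda>x. f x + g x) \<in> smooth_gen S"
| mult: "f \<in> smooth_gen S \<Longrightarrow> g \<in> smooth_gen S \<Longrightarrow> (\<lambda>x. f x * g x) \<in> smooth_gen S"
| affine: "f \<in> smooth_gen S \<Longrightarrow> (\<lambda>x. f (c *\<^sub>R x + d)) \<in> smooth_gen S"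
| comp: "\<eta> \<in> S \<Longrightarrow> f \<in> smooth_gen S \<Longrightarrow> (\<lambda>x. \<eta> (f x)) \<in> smooth_gen S"

text \<open>The sum, product and chain rules express every partial derivative of a generated
  function through generated functions, so the set satisfies the coinduction principle. Since
  \<open>base\<close> admits every smooth function, all closure rules for \<open>smooth\<close>
  follow at once.\<close>

lemma smooth_gen_smooth:
  assumes S: "smooth_real S" and f: "f \<in> smooth_gen S"
  shows "smooth f"
proof -
  have *: "(\<forall>x. g differentiable (at x)) \<and> (\<forall>i. partial i g \<in> smooth_gen S)"
    if "g \<in> smooth_gen S" for g :: "real^'n \<Rightarrow> real"
    using that
  proof induction
    case (base f)
    then show ?case
      using smooth_differentiable smooth_partial smooth_gen.base by blast
  next
    case (const c)
    have "partial i (\<lambda>x::real^'n. c) = (\<lambda>x. 0)" for i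
      by (rule ext, subst partial_eq[where D="\<lambda>x. 0"]) auto
    then show ?case by (auto intro: smooth_gen.const)
  next
    case (coord j)
    have D: "((\<lambda>x::real^'n. x $ j) has_derivative (\<lambda>h. h $ j)) (at x)" for x
      using bounded_linear_imp_has_derivative bounded_linear_vec_nth by blast
    have "partial i (\<lambda>x::real^'n. x $ j) = (\<lambda>x. axis i 1 $ j)" for i
      using partial_eq[OF D] by auto
    then show ?case using D by (auto intro: smooth_gen.const simp: differentiable_def)
  next
    case (add f g)
    have D: "((\<lambda>x. f x + g x) has_derivative
        (\<lambda>h. frechet_derivative f (at x) h + frechet_derivative g (at x) h)) (at x)" for x
      using add.IH by (intro has_derivative_add) (auto simp: frechet_derivative_works[symmetric])
    have "partial i (\<lambda>x. f x + g x) = (\<lambda>x. partial i f x + partial i g x)" for i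
      using partial_eq[OF D] by (auto simp: partial_def)
    then show ?case using D add.IH by (auto intro: smooth_gen.add simp: differentiable_def)
  next
    case (mult f g)
    have D: "((\<lambda>x. f x * g x) has_derivative
        (\<lambda>h. f x * frechet_derivative g (at x) h + frechet_derivative f (at x) h * g x)) (at x)" for x
      using mult.IH by (intro has_derivative_mult) (auto simp: frechet_derivative_works[symmetric])
    have "partial i (\<lambda>x. f x * g x) = (\<lambda>x. f x * partial i g x + partial i f x * g x)" for i
      using partial_eq[OF D] by (auto simp: partial_def)
    moreover have "(\<lambda>x. f x * partial i g x + partial i f x * g x) \<in> smooth_gen S" for i
      using mult by (intro smooth_gen.add smooth_gen.mult) auto
    ultimately show ?case using D by (auto simp: differentiable_def)
  next
    case (affine f c d)
    have D: "((\<lambda>x. f (c *\<^sub>R x + d)) has_derivative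
        (\<lambda>h. frechet_derivative f (at (c *\<^sub>R x + d)) (c *\<^sub>R h))) (at x)" for x
    proof -
      have "((\<lambda>x. c *\<^sub>R x + d) has_derivative (\<lambda>h. c *\<^sub>R h)) (at x)"
        by (auto intro!: derivative_eq_intros)
      moreover have "(f has_derivative frechet_derivative f (at (c *\<^sub>R x + d))) (at (c *\<^sub>R x + d))"
        using affine.IH by (simp add: frechet_derivative_works[symmetric])
      ultimately show ?thesis by (rule has_derivative_compose)
    qed
    have "frechet_derivative f (at y) (c *\<^sub>R h) = c * frechet_derivative f (at y) h" for y h
      using affine.IH linear_frechet_derivative[of f "at y"] by (simp add: linear_cmul)
    then have "partial i (\<lambda>x. f (c *\<^sub>R x + d)) = (\<lambda>x. c * partial i f (c *\<^sub>R x + d))" for i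
      using partial_eq[OF D] by (auto simp: partial_def)
    moreover have "(\<lambda>x. c * partial i f (c *\<^sub>R x + d)) \<in> smooth_gen S" for i
      using affine by (intro smooth_gen.const smooth_gen.affine smooth_gen.mult) auto
    ultimately show ?case using D by (auto simp: differentiable_def)
  next
    case (comp \<eta> f)
    then obtain \<eta>' where \<eta>': "\<eta>' \<in> S" "\<And>x. (\<eta> has_real_derivative \<eta>' x) (at x)"
      using S unfolding smooth_real_def by metis
    have D: "((\<lambda>x. \<eta> (f x)) has_derivative
        (\<lambda>h. \<eta>' (f x) * frechet_derivative f (at x) h)) (at x)" for x
    proof -
      have "(f has_derivative frechet_derivative f (at x)) (at x)"
        using comp.IH by (simp add: frechet_derivative_works[symmetric])
      moreover have "(\<eta> has_derivative (*) (\<eta>' (f x))) (at (f x))"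
        using \<eta>'(2) has_field_derivative_def by blast
      ultimately show ?thesis by (rule has_derivative_compose)
    qed
    have "partial i (\<lambda>x. \<eta> (f x)) = (\<lambda>x. \<eta>' (f x) * partial i f x)" for i
      using partial_eq[OF D] by (auto simp: partial_def)
    moreover have "(\<lambda>x. \<eta>' (f x) * partial i f x) \<in> smooth_gen S" for i
      using comp \<eta>'(1) smooth_gen.mult[OF smooth_gen.comp] by blast
    ultimately show ?case using D by (auto simp: differentiable_def)
  qed
  show ?thesis
    by (rule smooth_coinduct[OF f]) (use * in blast)+
qed

lemma smooth_real_empty: "smooth_real {}"
  by (simp add: smooth_real_def)

lemmas smooth_gen_empty = smooth_gen_smooth[OF smooth_real_empty]

lemma smooth_const: "smooth (\<lambda>x. c)"
  by (rule smooth_gen_empty) (rule smooth_gen.const)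

lemma smooth_coord: "smooth (\<lambda>x. x $ i)"
  by (rule smooth_gen_empty) (rule smooth_gen.coord)

lemma smooth_add: "smooth f \<Longrightarrow> smooth g \<Longrightarrow> smooth (\<lambda>x. f x + g x)"
  by (rule smooth_gen_empty) (intro smooth_gen.add smooth_gen.base)

lemma smooth_mult: "smooth f \<Longrightarrow> smooth g \<Longrightarrow> smooth (\<lambda>x. f x * g x)"
  by (rule smooth_gen_empty) (intro smooth_gen.mult smooth_gen.base)

lemma smooth_affine: "smooth f \<Longrightarrow> smooth (\<lambda>x. f (c *\<^sub>R x + d))"
  by (rule smooth_gen_empty) (intro smooth_gen.affine smooth_gen.base)

lemma smooth_sum: "finite A \<Longrightarrow> (\<And>i. i \<in> A \<Longrightarrow> smooth (f i)) \<Longrightarrow> smooth (\<lambda>x. \<Sum>i\<in>A. f i x)"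
  by (induction A rule: finite_induct) (auto intro: smooth_add smooth_const)

text \<open>Polynomials enter as the approximants supplied by Stone-Weierstrass. The linear case
  expands \<open>x\<close> in the coordinate basis.\<close>

lemma smooth_polynomial:
  fixes f :: "real^'n::finite \<Rightarrow> real"
  shows "real_polynomial_function f \<Longrightarrow> smooth f"
proof (induction rule: real_polynomial_function.induct)
  case (linear f)
  then interpret bounded_linear f .
  have "f x = (\<Sum>i\<in>UNIV. f (axis i 1) * x $ i)" for x
  proof -
    have "x = (\<Sum>i\<in>UNIV. x $ i *\<^sub>R axis i 1)"
      using basis_expansion[of x] by (simp add: scalar_mult_eq_scaleR)
    then have "f x = (\<Sum>i\<in>UNIV. f (x $ i *\<^sub>R axis i 1))"
      using sum[of "\<lambda>i. x $ i *\<^sub>R axis i 1" UNIV] by simp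
    then show ?thesis by (simp add: scaleR mult.commute)
  qed
  then have "f = (\<lambda>x. \<Sum>i\<in>UNIV. f (axis i 1) * x $ i)" by blast
  moreover have "smooth \<dots>" by (intro smooth_sum smooth_mult smooth_const smooth_coord) simp
  ultimately show ?case by simp
qed (auto intro: smooth_add smooth_mult smooth_const)

lemma partial_mult:
  assumes "f differentiable (at x)" "g differentiable (at x)"
  shows "partial i (\<lambda>x. f x * g x) x = f x * partial i g x + partial i f x * g x"
proof -
  have "((\<lambda>x. f x * g x) has_derivative
      (\<lambda>h. f x * frechet_derivative g (at x) h + frechet_derivative f (at x) h * g x)) (at x)"
    using assms by (intro has_derivative_mult) (auto simp: frechet_derivative_works[symmetric])
  from partial_eq[OF this] show ?thesis by (simp add: partial_def)
qed

lemma partial_affine: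
  assumes "smooth f"
  shows "partial i (\<lambda>x. f (c *\<^sub>R x + d)) x = c * partial i f (c *\<^sub>R x + d)"
proof -
  have f: "(f has_derivative frechet_derivative f (at (c *\<^sub>R x + d))) (at (c *\<^sub>R x + d))"
    using assms smooth_differentiable frechet_derivative_works by blast
  have "((\<lambda>x. c *\<^sub>R x + d) has_derivative (\<lambda>h. c *\<^sub>R h)) (at x)"
    by (auto intro!: derivative_eq_intros)
  from partial_eq[OF has_derivative_compose[OF this f]]
  show ?thesis
    using linear_cmul[OF has_derivative_linear[OF f]] by (simp add: partial_def)
qed

text \<open>\<open>frechet_derivative\<close> chooses among all derivatives at the point, so it
  suffices that both functions have the same derivatives there, whether or not any exists.\<close>

lemma partial_cong_open:
  assumes "open U" "x \<in> U" "\<And>y. y \<in> U \<Longrightarrow> f y = g y"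
  shows "partial i f x = partial i g x"
proof -
  have "(f has_derivative D) (at x) \<longleftrightarrow> (g has_derivative D) (at x)" for D
    using assms has_derivative_transform_within_open[of _ _ _ _ U] by metis
  then show ?thesis unfolding partial_def frechet_derivative_def by simp
qed

section \<open>Flat functions and a smooth bump\<close>

text \<open>Unlike \<open>exp (-1/t)\<close> alone, the whole family is closed under derivatives.\<close>

definition flat_exp :: "real poly \<Rightarrow> real \<Rightarrow> real" where
  "flat_exp q t = (if t > 0 then poly q (1/t) * exp (- (1/t)) else 0)"

lemma poly_exp_tendsto_0:
  fixes q :: "real poly"
  shows "((\<lambda>x. poly q x * exp (- x)) \<longlongrightarrow> 0) at_top"
proof -
  have "((\<lambda>x. \<Sum>i\<le>degree q. coeff q i * (x ^ i / exp x)) \<longlongrightarrow> (\<Sum>i\<le>degree q. coeff q i * 0)) at_top"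
    by (intro tendsto_intros tendsto_power_div_exp_0)
  moreover have "(\<lambda>x. \<Sum>i\<le>degree q. coeff q i * (x ^ i / exp x)) = (\<lambda>x. poly q x * exp (- x))"
    by (auto simp: poly_altdef sum_distrib_right sum_divide_distrib exp_minus divide_inverse mult.assoc)
  ultimately show ?thesis by simp
qed

lemma flat_exp_tendsto_0: "(flat_exp q \<longlongrightarrow> 0) (at 0)"
proof -
  have "((\<lambda>t. poly q (1/t) * exp (- (1/t))) \<longlongrightarrow> 0) (at_right 0)"
    using filterlim_compose[OF poly_exp_tendsto_0 filterlim_inverse_at_top_right, of q]
    by (simp add: inverse_eq_divide)
  moreover have "\<forall>\<^sub>F t in at_right 0. poly q (1/t) * exp (- (1/t)) = flat_exp q t"
    unfolding flat_exp_def by (auto simp: eventually_at_right_less eventually_at_filter)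
  ultimately have "(flat_exp q \<longlongrightarrow> 0) (at_right 0)"
    using tendsto_cong by fastforce
  moreover have "(flat_exp q \<longlongrightarrow> 0) (at_left 0)"
    by (rule tendsto_eventually) (auto simp: flat_exp_def eventually_at_filter)
  ultimately show ?thesis by (simp add: filterlim_split_at)
qed

text \<open>With \<open>y = 1/t\<close> one has \<open>d/dt = - y^2 d/dy\<close>, which sends
  \<open>q(y) exp(-y)\<close> to \<open>y^2 (q - q')(y) exp(-y)\<close>; the factor
  \<open>[:0,0,1:]\<close> is \<open>y^2\<close>.\<close>

lemma flat_exp_deriv:
  "(flat_exp q has_real_derivative flat_exp ([:0,0,1:] * (q - pderiv q)) t) (at t)"
proof -
  consider "t > 0" | "t < 0" | "t = 0" by linarith
  then show ?thesis
  proof cases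
    case 1
    have inv: "((\<lambda>t. 1 / t) has_real_derivative - (1/t) * (1/t)) (at t)"
      using 1 by (auto intro!: derivative_eq_intros simp: field_simps)
    have "((\<lambda>t. poly q (1/t) * exp (- (1/t))) has_real_derivative
        poly q (1/t) * (exp (- (1/t)) * - (- (1/t) * (1/t))) +
        poly (pderiv q) (1/t) * (- (1/t) * (1/t)) * exp (- (1/t))) (at t)"
      by (intro DERIV_mult' DERIV_fun_exp DERIV_minus inv DERIV_chain2[OF poly_DERIV])
    then have "((\<lambda>t. poly q (1/t) * exp (- (1/t))) has_real_derivative
        flat_exp ([:0,0,1:] * (q - pderiv q)) t) (at t)"
      using 1 by (simp add: flat_exp_def algebra_simps)
    moreover have "\<forall>\<^sub>F s in nhds t. poly q (1/s) * exp (- (1/s)) = flat_exp q s"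
      using 1 eventually_nhds_in_open[of "{0<..}" t]
      by (auto elim!: eventually_mono simp: flat_exp_def)
    ultimately show ?thesis by (rule DERIV_cong_ev[OF refl _ refl, THEN iffD1, rotated])
  next
    case 2
    have "((\<lambda>t. 0) has_real_derivative flat_exp ([:0,0,1:] * (q - pderiv q)) t) (at t)"
      using 2 by (simp add: flat_exp_def)
    moreover have "\<forall>\<^sub>F s in nhds t. 0 = flat_exp q s"
      using 2 eventually_nhds_in_open[of "{..<0}" t]
      by (auto elim!: eventually_mono simp: flat_exp_def)
    ultimately show ?thesis by (rule DERIV_cong_ev[OF refl _ refl, THEN iffD1, rotated])
  next
    case 3
    \<comment> \<open>At the origin, dividing by \<open>s\<close> multiplies \<open>q\<close> by its
      variable, so the difference quotient is again a flat function and tends to 0.\<close>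
    have "\<forall>\<^sub>F s in at 0. flat_exp (pCons 0 q) s = (flat_exp q s - flat_exp q 0) / (s - 0)"
      by (auto simp: eventually_at_filter flat_exp_def)
    then have "((\<lambda>s. (flat_exp q s - flat_exp q 0) / (s - 0)) \<longlongrightarrow> 0) (at 0)"
      using flat_exp_tendsto_0 tendsto_cong by fast
    then show ?thesis using 3
      by (simp add: has_field_derivative_iff flat_exp_def)
  qed
qed

lemma smooth_flat_exp: "smooth f \<Longrightarrow> smooth (\<lambda>x. flat_exp q (f x))"
proof (rule smooth_gen_smooth[of "range flat_exp"])
  show "smooth_real (range flat_exp)"
    unfolding smooth_real_def using flat_exp_deriv by blast
qed (auto intro: smooth_gen.comp smooth_gen.base)

text \<open>Two flat functions are nested. The inner one vanishes for \<open>norm x \<ge> 2\<close>;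
  the outer one makes the result constant once the inner value has reached
  \<open>e 3\<close>.\<close>

lemma smooth_bump_exists:
  obtains \<beta> :: "real^'n::finite \<Rightarrow> real"
  where "smooth \<beta>" "\<And>x. 0 \<le> \<beta> x" "\<And>x. \<beta> x \<le> 1"
    "\<And>x. norm x \<le> 1 \<Longrightarrow> \<beta> x = 1" "\<And>x. norm x \<ge> 2 \<Longrightarrow> \<beta> x = 0"
proof -
  define e where "e = flat_exp 1"
  have e_mono: "e s \<le> e t" if "s \<le> t" for s t
    using that by (auto simp: e_def flat_exp_def divide_left_mono)
  have e_0: "e t = 0" if "t \<le> 0" for t using that by (auto simp: e_def flat_exp_def)
  have e_nonneg: "e t \<ge> 0" for t by (auto simp: e_def flat_exp_def)
  have e_pos: "e t > 0" if "t > 0" for t using that by (auto simp: e_def flat_exp_def)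
  \<comment> \<open>The argument \<open>4 - |x|^2\<close> is at least 3 on the unit ball and at most
    0 from radius 2 on. It is written with coordinates so that the closure rules for
    \<open>smooth\<close> apply.\<close>
  define f :: "real^'n \<Rightarrow> real" where "f = (\<lambda>x. e (4 + (-1) * (\<Sum>i\<in>UNIV. x $ i * x $ i)))"
  define \<beta> where "\<beta> = (\<lambda>x. 1 + (- 1 / e 1) * e (1 + (- 1 / e 3) * f x))"
  have f: "f x = e (4 - (norm x)\<^sup>2)" for x
    by (simp add: f_def power2_norm_eq_inner inner_vec_def)
  have \<beta>: "\<beta> x = 1 - e (1 - f x / e 3) / e 1" for x by (simp add: \<beta>_def)
  have "smooth f" unfolding f_def e_def
    by (intro smooth_flat_exp smooth_add smooth_mult smooth_sum smooth_const smooth_coord) simp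
  then have "smooth \<beta>" unfolding \<beta>_def
    by (intro smooth_add smooth_mult smooth_const smooth_flat_exp[of _ 1, folded e_def])
  moreover have "0 \<le> \<beta> x" for x
    using e_mono[of "1 - f x / e 3" 1] e_pos[of 1] e_nonneg e_pos[of 3] by (simp add: \<beta> f)
  moreover have "\<beta> x \<le> 1" for x using e_nonneg by (simp add: \<beta>)
  moreover have "\<beta> x = 1" if "norm x \<le> 1" for x
  proof -
    have "(norm x)\<^sup>2 \<le> 1" using that by (simp add: abs_square_le_1)
    then have "f x \<ge> e 3" unfolding f by (intro e_mono) simp
    then show ?thesis using e_pos[of 3] by (simp add: \<beta> e_0)
  qed
  moreover have "\<beta> x = 0" if "norm x \<ge> 2" for x
  proof -
    have "(norm x)\<^sup>2 \<ge> 2\<^sup>2" using that by (intro power_mono) auto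
    then show ?thesis using e_pos[of 1] by (simp add: \<beta> f e_0)
  qed
  ultimately show ?thesis using that by blast
qed

subsection \<open>Test functions and weak derivatives\<close>

lemma test_functionI:
  assumes "smooth \<phi>" "\<And>x. R \<le> norm x \<Longrightarrow> \<phi> x = 0"
  shows "test_function \<phi>"
proof -
  have "closure {x. \<phi> x \<noteq> 0} \<subseteq> cball 0 R"
    using assms(2) by (intro closure_minimal) (auto intro: ccontr)
  then have "bounded (closure {x. \<phi> x \<noteq> 0})" using bounded_cball bounded_subset by blast
  then show ?thesis
    using assms(1) unfolding test_function_def smooth_def by (auto simp: compact_eq_bounded_closed)
qed

lemma test_functionE:
  assumes "test_function \<phi>"
  obtains R where "R > 0" "smooth \<phi>" "\<And>x. R \<le> norm x \<Longrightarrow> \<phi> x = 0"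
proof -
  have "bounded (closure {x. \<phi> x \<noteq> 0})"
    using assms compact_imp_bounded unfolding test_function_def by blast
  then obtain R where R: "\<And>x. x \<in> closure {x. \<phi> x \<noteq> 0} \<Longrightarrow> norm x \<le> R"
    unfolding bounded_iff by blast
  have "\<phi> x = 0" if "\<bar>R\<bar> + 1 \<le> norm x" for x
    using R[of x] that closure_subset[of "{x. \<phi> x \<noteq> 0}"] by fastforce
  then show ?thesis using that[of "\<bar>R\<bar> + 1"] assms unfolding test_function_def smooth_def by force
qed

text \<open>The strict inequality places \<open>x\<close> in an open region on which
  \<open>\<phi>\<close> vanishes identically.\<close>

lemma partial_zero_outside:
  assumes "\<And>x. R \<le> norm x \<Longrightarrow> \<phi> x = 0" "R < norm x"
  shows "partial i \<phi> x = 0"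
proof -
  have "open {x::real^'a. R < norm x}"
    using open_Collect_less[of "\<lambda>_. R" norm] by (simp add: continuous_on_norm_id)
  then have "partial i \<phi> x = partial i (\<lambda>x. 0) x"
    using assms by (intro partial_cong_open[of "{x. R < norm x}"]) auto
  also have "\<dots> = 0" by (rule partial_eq[where D="\<lambda>x. 0"]) simp
  finally show ?thesis .
qed

lemma continuous_compact_support_bounded:
  fixes f :: "'a::euclidean_space \<Rightarrow> real"
  assumes "continuous_on UNIV f" "\<And>x. R < norm x \<Longrightarrow> f x = 0"
  obtains C where "C > 0" "\<And>x. \<bar>f x\<bar> \<le> C"
proof -
  have "bounded (f ` cball 0 R)"
    using assms(1) by (intro compact_imp_bounded compact_continuous_image)
      (auto intro: continuous_on_subset)
  then obtain C where C: "C > 0" "\<And>x. x \<in> cball 0 R \<Longrightarrow> \<bar>f x\<bar> \<le> C"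
    unfolding bounded_pos by auto
  have "\<bar>f x\<bar> \<le> C" for x
    using C[of ] assms(2)[of x] by (cases "norm x \<le> R") auto
  then show ?thesis using that C(1) by blast
qed

lemma test_function_partial_bounded:
  assumes "test_function \<phi>"
  obtains C where "C > 0" "\<And>x. \<bar>partial i \<phi> x\<bar> \<le> C"
proof -
  obtain R where R: "smooth \<phi>" "\<And>x. R \<le> norm x \<Longrightarrow> \<phi> x = 0"
    using test_functionE[OF assms] by blast
  show ?thesis
  proof (rule continuous_compact_support_bounded)
    show "continuous_on UNIV (partial i \<phi>)"
      by (rule smooth_continuous[OF smooth_partial[OF R(1)]])
    show "partial i \<phi> x = 0" if "R < norm x" for x
      using partial_zero_outside[of R \<phi>, OF R(2) that] .
  qed (rule that)
qed

lemma test_function_mult: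
  assumes "test_function f" "smooth g" shows "test_function (\<lambda>x. g x * f x)"
proof -
  obtain R where R: "smooth f" "\<And>x. R \<le> norm x \<Longrightarrow> f x = 0"
    using test_functionE[OF assms(1)] by blast
  show ?thesis
    by (rule test_functionI[of _ R]) (auto intro: smooth_mult assms simp: R)
qed

lemma test_function_affine:
  assumes "test_function f" "c \<noteq> 0" shows "test_function (\<lambda>x. f (c *\<^sub>R x + d))"
proof -
  obtain R where R: "smooth f" "\<And>x. R \<le> norm x \<Longrightarrow> f x = 0"
    using test_functionE[OF assms(1)] by blast
  show ?thesis
  proof (rule test_functionI)
    show "f (c *\<^sub>R x + d) = 0" if "(R + norm d) / \<bar>c\<bar> \<le> norm x" for x
    proof -
      have "R + norm d \<le> norm (c *\<^sub>R x)" using that assms(2) by (simp add: field_simps)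
      then show ?thesis using norm_diff_ineq[of "c *\<^sub>R x" d] by (intro R(2)) linarith
    qed
  qed (rule smooth_affine[OF R(1)])
qed

lemma has_real_derivative_line:
  assumes "smooth \<phi>"
  shows "((\<lambda>t. \<phi> (x + t *\<^sub>R axis i 1)) has_real_derivative partial i \<phi> (x + t *\<^sub>R axis i 1)) (at t)"
proof -
  let ?y = "x + t *\<^sub>R axis i 1"
  have f: "(\<phi> has_derivative frechet_derivative \<phi> (at ?y)) (at ?y)"
    using assms smooth_differentiable frechet_derivative_works by blast
  have "((\<lambda>t. x + t *\<^sub>R axis i 1) has_derivative (\<lambda>h. h *\<^sub>R axis i (1::real))) (at t)"
    by (auto intro!: derivative_eq_intros)
  from has_derivative_compose[OF this f] show ?thesis
    using linear_cmul[OF has_derivative_linear[OF f]]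
    by (simp add: has_field_derivative_def partial_def mult_commute_abs)
qed

lemma smooth_lipschitz_line:
  assumes "smooth \<phi>" "\<And>x. \<bar>partial i \<phi> x\<bar> \<le> C"
  shows "\<bar>\<phi> (x + h *\<^sub>R axis i 1) - \<phi> x\<bar> \<le> C * \<bar>h\<bar>"
proof -
  have "norm (\<phi> (x + h *\<^sub>R axis i 1) - \<phi> (x + 0 *\<^sub>R axis i 1)) \<le> C * norm (h - 0)"
    by (rule field_differentiable_bound[of UNIV _ "\<lambda>t. partial i \<phi> (x + t *\<^sub>R axis i 1)"])
      (use assms has_real_derivative_line in auto)
  then show ?thesis by simp
qed

section \<open>Locally integrable functions and pairings with compactly supported functions\<close>

lemma L1_loc_continuous: "continuous_on UNIV f \<Longrightarrow> f \<in> L1_loc"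
  unfolding L1_loc_def set_integrable_def
proof safe
  fix K :: "(real^'a) set" assume f: "continuous_on UNIV f" and K: "compact K"
  then have *: "integrable lborel (\<lambda>x. indicator K x *\<^sub>R f x)"
    by (intro borel_integrable_compact) (auto intro: continuous_on_subset)
  show "integrable lebesgue (\<lambda>x. indicator K x *\<^sub>R f x)"
    using * borel_measurable_integrable[OF *] by (subst integrable_completion) auto
qed

lemma L1_loc_add: "f \<in> L1_loc \<Longrightarrow> g \<in> L1_loc \<Longrightarrow> (\<lambda>x. f x + g x) \<in> L1_loc"
  unfolding L1_loc_def by (auto intro: set_integral_add)

lemma L1_loc_mult_continuous:
  assumes "g \<in> L1_loc" "continuous_on UNIV f"
  shows "(\<lambda>x. f x * g x) \<in> L1_loc"
  unfolding L1_loc_def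
proof safe
  fix K :: "(real^'a) set" assume K: "compact K"
  show "(\<lambda>x. f x * g x) absolutely_integrable_on K"
  proof (rule absolutely_integrable_bounded_measurable_product[OF bilinear_times])
    show "f \<in> borel_measurable (lebesgue_on K)"
      using K assms(2) by (intro continuous_imp_measurable_on_sets_lebesgue)
       (auto intro: continuous_on_subset simp: lmeasurable_compact fmeasurableD)
    show "bounded (f ` K)"
      using K assms(2) by (intro compact_imp_bounded compact_continuous_image)
        (auto intro: continuous_on_subset)
  qed (use K assms(1) in \<open>auto simp: L1_loc_def lmeasurable_compact fmeasurableD\<close>)
qed

lemma L1_loc_integrable_cball:
  assumes "g \<in> L1_loc" shows "integrable lebesgue (\<lambda>x. indicator (cball 0 R) x * \<bar>g x\<bar>)"
proof -
  have "g absolutely_integrable_on cball 0 R" using assms by (auto simp: L1_loc_def)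
  then have "integrable lebesgue (\<lambda>x. norm (indicator (cball 0 R) x *\<^sub>R g x))"
    unfolding set_integrable_def by (rule integrable_norm)
  then show ?thesis by (simp add: abs_mult)
qed

text \<open>The truncations to balls of integer radius are integrable, hence measurable, and at each
  point they are eventually equal to \<open>g\<close>.\<close>

lemma L1_loc_measurable:
  assumes "g \<in> L1_loc" shows "g \<in> borel_measurable lebesgue"
proof (rule borel_measurable_LIMSEQ_real)
  show "(\<lambda>x. indicator (cball 0 (real n)) x * g x) \<in> borel_measurable lebesgue" for n
  proof -
    have "g absolutely_integrable_on cball 0 (real n)" using assms by (auto simp: L1_loc_def)
    then show ?thesis unfolding set_integrable_def by (auto dest: borel_measurable_integrable)
  qed
  show "(\<lambda>n. indicator (cball 0 (real n)) x * g x) \<longlonglongrightarrow> g x" for x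
  proof (rule tendsto_eventually)
    obtain N where "norm x \<le> real N" using real_arch_simple by blast
    then have "\<forall>n\<ge>N. norm x \<le> real n" by (meson of_nat_le_iff order_trans)
    then show "\<forall>\<^sub>F n in sequentially. indicator (cball 0 (real n)) x * g x = g x"
      unfolding eventually_sequentially by (intro exI[of _ N]) (auto simp: indicator_def)
  qed
qed

lemma L1_loc_integral_bound:
  assumes g: "g \<in> L1_loc" and \<psi>: "\<psi> \<in> borel_measurable lebesgue"
    and B: "\<And>x. \<bar>\<psi> x\<bar> \<le> B" and R: "\<And>x. R < norm x \<Longrightarrow> \<psi> x = 0"
  shows "integrable lebesgue (\<lambda>x. g x * \<psi> x)"
    and "\<bar>\<integral>x. g x * \<psi> x \<partial>lebesgue\<bar> \<le> B * (\<integral>x. indicator (cball 0 R) x * \<bar>g x\<bar> \<partial>lebesgue)"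
proof -
  have B0: "B \<ge> 0" using B[of undefined] by linarith
  have int: "integrable lebesgue (\<lambda>x. B * (indicator (cball 0 R) x * \<bar>g x\<bar>))"
    using L1_loc_integrable_cball[OF g] by simp
  have bd: "norm (g x * \<psi> x) \<le> norm (B * (indicator (cball 0 R) x * \<bar>g x\<bar>))" for x
    using B[of x] R[of x] B0
    by (cases "norm x \<le> R") (auto simp: abs_mult mult.commute mult_right_mono)
  show i: "integrable lebesgue (\<lambda>x. g x * \<psi> x)"
    by (rule Bochner_Integration.integrable_bound[OF int])
      (use L1_loc_measurable[OF g] \<psi> bd in auto)
  have "norm (\<integral>x. g x * \<psi> x \<partial>lebesgue) \<le> (\<integral>x. B * (indicator (cball 0 R) x * \<bar>g x\<bar>) \<partial>lebesgue)"
  proof (rule Bochner_Integration.integral_norm_bound_integral[OF i int])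
    show "norm (g x * \<psi> x) \<le> B * (indicator (cball 0 R) x * \<bar>g x\<bar>)" for x
      using bd[of x] B0 by simp
  qed
  then show "\<bar>\<integral>x. g x * \<psi> x \<partial>lebesgue\<bar> \<le> B * (\<integral>x. indicator (cball 0 R) x * \<bar>g x\<bar> \<partial>lebesgue)"
    by simp
qed

lemma continuous_measurable_lebesgue:
  fixes f :: "'a::euclidean_space \<Rightarrow> real"
  shows "continuous_on UNIV f \<Longrightarrow> f \<in> borel_measurable lebesgue"
  by (simp add: borel_measurable_continuous_onI measurable_completion)

lemma integrable_L1_loc_mult:
  assumes "g \<in> L1_loc" "continuous_on UNIV \<psi>" "\<And>x. R < norm x \<Longrightarrow> \<psi> x = 0"
  shows "integrable lebesgue (\<lambda>x. g x * \<psi> x)"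
proof -
  obtain C where "\<And>x. \<bar>\<psi> x\<bar> \<le> C"
    using continuous_compact_support_bounded[OF assms(2,3)] by metis
  then show ?thesis using L1_loc_integral_bound(1) continuous_measurable_lebesgue assms by blast
qed

text \<open>Continuity gives Borel measurability, which moves both integrals to
  \<open>lborel\<close> and its translation invariance.\<close>

lemma integral_translation_continuous:
  fixes f :: "'a::euclidean_space \<Rightarrow> real"
  assumes "continuous_on UNIV f"
  shows "(\<integral>x. f (x + a) \<partial>lebesgue) = (\<integral>x. f x \<partial>lebesgue)"
proof -
  have [measurable]: "f \<in> borel_measurable borel"
    using assms by (rule borel_measurable_continuous_onI)
  have "(\<integral>x. f (x + a) \<partial>lebesgue) = (\<integral>x. f (a + x) \<partial>lborel)"
    by (subst integral_completion) (auto simp: add.commute)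
  also have "\<dots> = (\<integral>x. f x \<partial>distr lborel borel ((+) a))"
    by (subst integral_distr) auto
  also have "\<dots> = (\<integral>x. f x \<partial>lebesgue)"
    by (subst lborel_distr_plus, subst integral_completion) auto
  finally show ?thesis .
qed

text \<open>Dominated convergence along a sequence \<open>h n\<close>. The quotients are bounded by
  the supremum of the partial derivative and, \<open>H\<close> bounding the sequence, all vanish
  outside the ball of radius \<open>R + H\<close>.\<close>

lemma L1_loc_difference_quotient_tendsto:
  assumes u: "u \<in> L1_loc" and \<phi>: "test_function \<phi>"
  shows "((\<lambda>h. \<integral>x. u x * ((\<phi> (x + h *\<^sub>R axis i 1) - \<phi> x) / h) \<partial>lebesgue)
    \<longlongrightarrow> (\<integral>x. u x * partial i \<phi> x \<partial>lebesgue)) (at 0)"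
proof -
  obtain R where R: "smooth \<phi>" "\<And>x. R \<le> norm x \<Longrightarrow> \<phi> x = 0"
    using test_functionE[OF \<phi>] by blast
  obtain C where C: "C > 0" "\<And>x. \<bar>partial i \<phi> x\<bar> \<le> C"
    using test_function_partial_bounded[OF \<phi>] by blast
  show ?thesis
    unfolding tendsto_at_iff_sequentially comp_def
  proof safe
    fix h :: "nat \<Rightarrow> real" assume h: "\<forall>n. h n \<in> UNIV - {0}" "h \<longlonglongrightarrow> 0"
    obtain H where H: "\<And>n. \<bar>h n\<bar> \<le> H"
      using convergent_imp_Bseq[OF convergentI[OF h(2)]] by (auto simp: Bseq_def)
    have h0: "h n \<noteq> 0" for n using h(1) by auto
    let ?\<psi> = "\<lambda>n x. (\<phi> (x + h n *\<^sub>R axis i 1) - \<phi> x) / h n"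
    have meas: "?\<psi> n \<in> borel_measurable lebesgue" for n
      using h0 by (intro continuous_measurable_lebesgue continuous_intros smooth_continuous[OF R(1)]
        continuous_on_compose2[OF smooth_continuous[OF R(1), of UNIV]]) auto
    have \<psi>C: "\<bar>?\<psi> n x\<bar> \<le> C" for n x
      using smooth_lipschitz_line[OF R(1) C(2), of x "h n"] h0[of n] by (simp add: field_simps)
    have \<psi>0: "?\<psi> n x = 0" if "R + H < norm x" for n x
    proof -
      have "norm x \<le> norm (x + h n *\<^sub>R axis i 1) + \<bar>h n\<bar>"
        using norm_triangle_ineq4[of "x + h n *\<^sub>R axis i 1" "h n *\<^sub>R axis i 1"] by simp
      then show ?thesis using that H[of n] R(2) by (auto simp: R(2))
    qed
    show "(\<lambda>n. \<integral>x. u x * ?\<psi> n x \<partial>lebesgue) \<longlonglongrightarrow> (\<integral>x. u x * partial i \<phi> x \<partial>lebesgue)"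
    proof (rule integral_dominated_convergence[where w="\<lambda>x. C * (indicator (cball 0 (R + H)) x * \<bar>u x\<bar>)"])
      show "(\<lambda>x. u x * partial i \<phi> x) \<in> borel_measurable lebesgue"
        using L1_loc_measurable[OF u] continuous_measurable_lebesgue[OF smooth_continuous[OF smooth_partial[OF R(1)]]]
        by (rule borel_measurable_times)
      show "(\<lambda>x. u x * ?\<psi> n x) \<in> borel_measurable lebesgue" for n
        using L1_loc_measurable[OF u] meas by (rule borel_measurable_times)
      show "integrable lebesgue (\<lambda>x. C * (indicator (cball 0 (R + H)) x * \<bar>u x\<bar>))"
        using L1_loc_integrable_cball[OF u] by simp
      show "AE x in lebesgue. norm (u x * ?\<psi> n x) \<le> C * (indicator (cball 0 (R + H)) x * \<bar>u x\<bar>)" for n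
      proof (rule AE_I2)
        fix x
        show "norm (u x * ?\<psi> n x) \<le> C * (indicator (cball 0 (R + H)) x * \<bar>u x\<bar>)"
        proof (cases "norm x \<le> R + H")
          case True
          have "norm (u x * ?\<psi> n x) = \<bar>?\<psi> n x\<bar> * \<bar>u x\<bar>" by (simp only: real_norm_def abs_mult mult.commute)
          also have "\<dots> \<le> C * \<bar>u x\<bar>" by (rule mult_right_mono[OF \<psi>C]) simp
          finally show ?thesis using True by simp
        next
          case False
          then have "?\<psi> n x = 0" by (intro \<psi>0) simp
          then show ?thesis using False by (simp del: divide_eq_0_iff)
        qed
      qed
      show "AE x in lebesgue. (\<lambda>n. u x * ?\<psi> n x) \<longlonglongrightarrow> u x * partial i \<phi> x"
      proof (intro AE_I2 tendsto_mult tendsto_const)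
        fix x
        have "((\<lambda>t. (\<phi> (x + t *\<^sub>R axis i 1) - \<phi> (x + 0 *\<^sub>R axis i 1)) / (t - 0)) \<longlongrightarrow>
            partial i \<phi> (x + 0 *\<^sub>R axis i 1)) (at 0)"
          using has_real_derivative_line[OF R(1), of x i 0] by (simp only: has_field_derivative_iff)
        then show "(\<lambda>n. ?\<psi> n x) \<longlonglongrightarrow> partial i \<phi> x"
          using h unfolding tendsto_at_iff_sequentially comp_def by simp
      qed
    qed
  qed
qed

text \<open>Pair the difference quotients with the constant 1: each integral is 0 by translation
  invariance, and the limit is the integral of the derivative.\<close>

lemma integral_partial_test_function:
  assumes "test_function \<phi>" shows "(\<integral>x. partial i \<phi> x \<partial>lebesgue) = 0"
proof -
  obtain R where R: "smooth \<phi>" "\<And>x. R \<le> norm x \<Longrightarrow> \<phi> x = 0"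
    using test_functionE[OF assms] by blast
  have 1: "(\<lambda>x::real^'a. 1) \<in> L1_loc" by (simp add: L1_loc_continuous)
  have "(\<lambda>h. \<integral>x. 1 * ((\<phi> (x + h *\<^sub>R axis i 1) - \<phi> x) / h) \<partial>lebesgue) = (\<lambda>h. 0)"
  proof
    fix h
    obtain Q where Q: "\<And>x. Q \<le> norm x \<Longrightarrow> \<phi> (x + h *\<^sub>R axis i 1) = 0"
      using test_functionE[OF test_function_affine[OF assms, of 1 "h *\<^sub>R axis i 1"]] by auto
    have i1: "integrable lebesgue \<phi>"
      using integrable_L1_loc_mult[OF 1 smooth_continuous[OF R(1)], of R] R(2) by simp
    have i2: "integrable lebesgue (\<lambda>x. \<phi> (x + h *\<^sub>R axis i 1))"
      using integrable_L1_loc_mult[OF 1, of "\<lambda>x. \<phi> (x + h *\<^sub>R axis i 1)" Q] Q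
        smooth_continuous[OF smooth_affine[OF R(1), of 1]] by simp
    show "(\<integral>x. 1 * ((\<phi> (x + h *\<^sub>R axis i 1) - \<phi> x) / h) \<partial>lebesgue) = 0"
      using i1 i2 integral_translation_continuous[OF smooth_continuous[OF R(1)]] by simp
  qed
  then have "((\<lambda>h. 0::real) \<longlongrightarrow> (\<integral>x. 1 * partial i \<phi> x \<partial>lebesgue)) (at (0::real))"
    using L1_loc_difference_quotient_tendsto[OF 1 assms, of i] by (simp only:)
  then show ?thesis using tendsto_const_iff[of "at (0::real)" 0 "\<integral>x. 1 * partial i \<phi> x \<partial>lebesgue"] by simp
qed

section \<open>Calculus of weak partial derivatives\<close>

lemma has_weak_partial_smooth:
  assumes "smooth f" shows "has_weak_partial i f (partial i f)"
  unfolding has_weak_partial_def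
proof (intro conjI allI impI)
  show "f \<in> L1_loc" "partial i f \<in> L1_loc"
    using assms by (auto intro: L1_loc_continuous smooth_continuous smooth_partial)
  fix \<phi> :: "real^'a \<Rightarrow> real" assume \<phi>: "test_function \<phi>"
  obtain R where R: "smooth \<phi>" "\<And>x. R \<le> norm x \<Longrightarrow> \<phi> x = 0"
    using test_functionE[OF \<phi>] by blast
  have i1: "integrable lebesgue (\<lambda>x. f x * partial i \<phi> x)"
    using assms R partial_zero_outside[of R \<phi>, OF R(2)]
    by (intro integrable_L1_loc_mult L1_loc_continuous smooth_continuous smooth_partial)
  have i2: "integrable lebesgue (\<lambda>x. partial i f x * \<phi> x)"
    using assms R by (intro integrable_L1_loc_mult[of _ _ R] L1_loc_continuous smooth_continuous smooth_partial) auto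
  \<comment> \<open>Integration by parts: the product \<open>f \<phi>\<close> is a test function, so
    its derivative integrates to 0, and the Leibniz rule splits that integral.\<close>
  have "0 = (\<integral>x. partial i (\<lambda>x. f x * \<phi> x) x \<partial>lebesgue)"
    using integral_partial_test_function[OF test_function_mult[OF \<phi> assms]] by simp
  also have "\<dots> = (\<integral>x. f x * partial i \<phi> x + partial i f x * \<phi> x \<partial>lebesgue)"
    using assms R(1) by (simp add: partial_mult smooth_differentiable)
  also have "\<dots> = (\<integral>x. f x * partial i \<phi> x \<partial>lebesgue) + (\<integral>x. partial i f x * \<phi> x \<partial>lebesgue)"
    using i1 i2 by simp
  finally show "(\<integral>x. f x * partial i \<phi> x \<partial>lebesgue) = - (\<integral>x. partial i f x * \<phi> x \<partial>lebesgue)"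
    by simp
qed

lemma has_weak_partial_add:
  assumes "has_weak_partial i f f'" "has_weak_partial i g g'"
  shows "has_weak_partial i (\<lambda>x. f x + g x) (\<lambda>x. f' x + g' x)"
  unfolding has_weak_partial_def
proof (intro conjI allI impI)
  have L: "f \<in> L1_loc" "g \<in> L1_loc" "f' \<in> L1_loc" "g' \<in> L1_loc"
    using assms by (auto simp: has_weak_partial_def)
  then show "(\<lambda>x. f x + g x) \<in> L1_loc" "(\<lambda>x. f' x + g' x) \<in> L1_loc"
    by (auto intro: L1_loc_add)
  fix \<phi> :: "real^'a \<Rightarrow> real" assume \<phi>: "test_function \<phi>"
  obtain R where R: "smooth \<phi>" "\<And>x. R \<le> norm x \<Longrightarrow> \<phi> x = 0"
    using test_functionE[OF \<phi>] by blast
  have i: "integrable lebesgue (\<lambda>x. v x * partial i \<phi> x)" "integrable lebesgue (\<lambda>x. v x * \<phi> x)"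
    if "v \<in> L1_loc" for v
    using that R partial_zero_outside[of R \<phi>, OF R(2)] integrable_L1_loc_mult[of v "partial i \<phi>" R]
      integrable_L1_loc_mult[of v \<phi> R]
    by (auto intro: smooth_continuous smooth_partial)
  show "(\<integral>x. (f x + g x) * partial i \<phi> x \<partial>lebesgue) = - (\<integral>x. (f' x + g' x) * \<phi> x \<partial>lebesgue)"
    using assms \<phi> by (simp add: has_weak_partial_def i L distrib_right)
qed

lemma has_weak_partial_cmult:
  assumes "has_weak_partial i f f'"
  shows "has_weak_partial i (\<lambda>x. c * f x) (\<lambda>x. c * f' x)"
  using assms L1_loc_mult_continuous[of f "\<lambda>_. c"] L1_loc_mult_continuous[of f' "\<lambda>_. c"]
  unfolding has_weak_partial_def by (simp add: mult.assoc)

text \<open>Use \<open>g \<phi>\<close> as test function for \<open>f\<close>; its Leibniz rule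
  produces the term with \<open>partial i g\<close>, which is moved to the other side.\<close>

lemma has_weak_partial_mult_smooth:
  assumes f: "has_weak_partial i f f'" and g: "smooth g"
  shows "has_weak_partial i (\<lambda>x. g x * f x) (\<lambda>x. g x * f' x + partial i g x * f x)"
  unfolding has_weak_partial_def
proof (intro conjI allI impI)
  have L: "f \<in> L1_loc" "f' \<in> L1_loc"
    using f by (auto simp: has_weak_partial_def)
  then show "(\<lambda>x. g x * f x) \<in> L1_loc" "(\<lambda>x. g x * f' x + partial i g x * f x) \<in> L1_loc"
    using g by (auto intro!: L1_loc_add L1_loc_mult_continuous smooth_continuous smooth_partial)
  fix \<phi> :: "real^'a \<Rightarrow> real" assume \<phi>: "test_function \<phi>"
  obtain R where R: "smooth \<phi>" "\<And>x. R \<le> norm x \<Longrightarrow> \<phi> x = 0"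
    using test_functionE[OF \<phi>] by blast
  have t: "test_function (\<lambda>x. g x * \<phi> x)" using \<phi> g by (rule test_function_mult)
  have i1: "integrable lebesgue (\<lambda>x. f x * (g x * partial i \<phi> x))"
    by (rule integrable_L1_loc_mult[OF L(1), of _ R])
      (use R g partial_zero_outside[of R \<phi>, OF R(2)] in \<open>auto intro!: smooth_mult smooth_continuous smooth_partial\<close>)
  have i2: "integrable lebesgue (\<lambda>x. f x * (partial i g x * \<phi> x))"
    by (rule integrable_L1_loc_mult[OF L(1), of _ R])
      (use R g in \<open>auto intro!: smooth_mult smooth_continuous smooth_partial\<close>)
  have i3: "integrable lebesgue (\<lambda>x. f' x * (g x * \<phi> x))"
    by (rule integrable_L1_loc_mult[OF L(2), of _ R])
      (use R g in \<open>auto intro!: smooth_mult smooth_continuous smooth_partial\<close>)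
  have "- (\<integral>x. f' x * (g x * \<phi> x) \<partial>lebesgue) = (\<integral>x. f x * partial i (\<lambda>x. g x * \<phi> x) x \<partial>lebesgue)"
    using f t unfolding has_weak_partial_def by auto
  also have "\<dots> = (\<integral>x. f x * (g x * partial i \<phi> x) + f x * (partial i g x * \<phi> x) \<partial>lebesgue)"
    using g R(1) by (simp add: partial_mult smooth_differentiable distrib_left)
  also have "\<dots> = (\<integral>x. f x * (g x * partial i \<phi> x) \<partial>lebesgue) + (\<integral>x. f x * (partial i g x * \<phi> x) \<partial>lebesgue)"
    using i1 i2 by simp
  finally have "(\<integral>x. f x * (g x * partial i \<phi> x) \<partial>lebesgue) =
    - ((\<integral>x. f' x * (g x * \<phi> x) \<partial>lebesgue) + (\<integral>x. f x * (partial i g x * \<phi> x) \<partial>lebesgue))" by simp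
  also have "\<dots> = - (\<integral>x. (g x * f' x + partial i g x * f x) * \<phi> x \<partial>lebesgue)"
    using Bochner_Integration.integral_add[OF i3 i2] by (simp add: distrib_right mult_ac distrib_left)
  finally show "(\<integral>x. (g x * f x) * partial i \<phi> x \<partial>lebesgue) =
      - (\<integral>x. (g x * f' x + partial i g x * f x) * \<phi> x \<partial>lebesgue)" by (simp add: mult_ac)
qed

subsection \<open>Uniqueness and difference quotients\<close>

text \<open>Multiply a polynomial approximant on the ball of radius \<open>2 * R\<close> by a cutoff
  equal to 1 on radius \<open>R\<close>. In the shell between the radii \<open>\<psi>\<close>
  vanishes, so the polynomial is already small there and the cutoff does no harm.\<close>

lemma test_function_approx:
  fixes \<psi> :: "real^'n::finite \<Rightarrow> real"
  assumes "continuous_on UNIV \<psi>" "R > 0" "\<And>x. R \<le> norm x \<Longrightarrow> \<psi> x = 0" "\<epsilon> > 0"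
  obtains q where "test_function q" "\<And>x. 2 * R \<le> norm x \<Longrightarrow> q x = 0" "\<And>x. \<bar>\<psi> x - q x\<bar> \<le> \<epsilon>"
proof -
  obtain \<beta> :: "real^'n \<Rightarrow> real" where \<beta>: "smooth \<beta>" "\<And>x. 0 \<le> \<beta> x" "\<And>x. \<beta> x \<le> 1"
    "\<And>x. norm x \<le> 1 \<Longrightarrow> \<beta> x = 1" "\<And>x. norm x \<ge> 2 \<Longrightarrow> \<beta> x = 0"
    using smooth_bump_exists by blast
  obtain P where P: "real_polynomial_function P" "\<And>x. x \<in> cball 0 (2 * R) \<Longrightarrow> \<bar>\<psi> x - P x\<bar> < \<epsilon>"
    using Stone_Weierstrass_real_polynomial_function[of "cball 0 (2 * R)" \<psi> \<epsilon>] assms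
    by (metis compact_cball continuous_on_subset top_greatest)
  define q where "q = (\<lambda>x. \<beta> ((1 / R) *\<^sub>R x + 0) * P x)"
  have q0: "q x = 0" if "2 * R \<le> norm x" for x
    using that \<beta>(5)[of "(1 / R) *\<^sub>R x + 0"] \<open>R > 0\<close> by (simp add: q_def field_simps)
  have "test_function q"
    by (rule test_functionI[OF _ q0]) (unfold q_def, intro smooth_mult smooth_affine \<beta>(1) smooth_polynomial P(1))
  moreover have "\<bar>\<psi> x - q x\<bar> \<le> \<epsilon>" for x
  proof -
    consider "norm x \<le> R" | "R \<le> norm x" "norm x \<le> 2 * R" | "2 * R \<le> norm x" by linarith
    then show ?thesis
    proof cases
      case 1
      then have "q x = P x" using \<beta>(4)[of "(1 / R) *\<^sub>R x"] \<open>R > 0\<close> by (simp add: q_def)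
      then show ?thesis using P(2)[of x] 1 \<open>R > 0\<close> by simp
    next
      case 2
      have "\<bar>q x\<bar> \<le> 1 * \<bar>P x\<bar>"
        unfolding q_def abs_mult using \<beta>(2,3) by (intro mult_right_mono) auto
      then show ?thesis using P(2)[of x] 2 assms(3)[of x] by simp
    next
      case 3
      then show ?thesis using q0 assms(2,3,4) by simp
    qed
  qed
  ultimately show ?thesis using that q0 by blast
qed

text \<open>Uniform density: approximants share a support of radius \<open>2 * R\<close>, so the
  error in the pairing is at most \<open>\<epsilon>\<close> times the mass of \<open>w\<close>
  there, and their bound is \<open>B + \<epsilon>\<close>.\<close>

lemma test_function_bound_extends:
  fixes \<psi> w :: "real^'n::finite \<Rightarrow> real"
  assumes w: "w \<in> L1_loc" and \<psi>: "continuous_on UNIV \<psi>" "\<And>x. R \<le> norm x \<Longrightarrow> \<psi> x = 0"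
    "\<And>x. \<bar>\<psi> x\<bar> \<le> B" and "R > 0"
    and test: "\<And>q C. test_function q \<Longrightarrow> (\<And>x. 2 * R \<le> norm x \<Longrightarrow> q x = 0) \<Longrightarrow> (\<And>x. \<bar>q x\<bar> \<le> C) \<Longrightarrow>
      \<bar>\<integral>x. w x * q x \<partial>lebesgue\<bar> \<le> C * \<Gamma>"
  shows "\<bar>\<integral>x. w x * \<psi> x \<partial>lebesgue\<bar> \<le> B * \<Gamma>"
proof (rule ccontr)
  assume neg: "\<not> ?thesis"
  define W where "W = (\<integral>x. indicator (cball 0 (2 * R)) x * \<bar>w x\<bar> \<partial>lebesgue)"
  have W0: "W \<ge> 0" unfolding W_def by (intro integral_nonneg_AE) auto
  define d where "d = \<bar>\<integral>x. w x * \<psi> x \<partial>lebesgue\<bar> - B * \<Gamma>"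
  have d: "d > 0" using neg by (simp add: d_def)
  \<comment> \<open>Chosen so that the total error \<open>\<epsilon> * (W + \<Gamma>)\<close> is at
    most half of the supposed excess \<open>d\<close>; the summand 1 keeps the denominator
    positive.\<close>
  define \<epsilon> where "\<epsilon> = d / (2 * (W + \<bar>\<Gamma>\<bar> + 1))"
  have \<epsilon>: "\<epsilon> > 0" using d W0 by (simp add: \<epsilon>_def)
  obtain q where q: "test_function q" "\<And>x. 2 * R \<le> norm x \<Longrightarrow> q x = 0" "\<And>x. \<bar>\<psi> x - q x\<bar> \<le> \<epsilon>"
    using test_function_approx[OF \<psi>(1) \<open>R > 0\<close> \<psi>(2) \<epsilon>] by blast
  have cq: "continuous_on UNIV q" using q(1) smooth_continuous test_functionE by metis
  have "\<bar>q x\<bar> \<le> B + \<epsilon>" for x using q(3)[of x] \<psi>(3)[of x] by linarith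
  then have 1: "\<bar>\<integral>x. w x * q x \<partial>lebesgue\<bar> \<le> (B + \<epsilon>) * \<Gamma>" using test[OF q(1,2)] by blast
  have 2: "\<bar>\<integral>x. w x * (\<psi> x - q x) \<partial>lebesgue\<bar> \<le> \<epsilon> * W"
    unfolding W_def
  proof (rule L1_loc_integral_bound(2)[OF w _ q(3)])
    show "(\<lambda>x. \<psi> x - q x) \<in> borel_measurable lebesgue"
      by (intro continuous_measurable_lebesgue continuous_intros \<psi>(1) cq)
    show "\<psi> x - q x = 0" if "2 * R < norm x" for x
      using that q(2)[of x] \<psi>(2)[of x] \<open>R > 0\<close> by simp
  qed
  have "integrable lebesgue (\<lambda>x. w x * q x)" "integrable lebesgue (\<lambda>x. w x * \<psi> x)"
    using integrable_L1_loc_mult[OF w cq, of "2 * R"] integrable_L1_loc_mult[OF w \<psi>(1), of R] q(2) \<psi>(2)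
    by auto
  then have "(\<integral>x. w x * (\<psi> x - q x) \<partial>lebesgue) = (\<integral>x. w x * \<psi> x \<partial>lebesgue) - (\<integral>x. w x * q x \<partial>lebesgue)"
    by (simp add: right_diff_distrib)
  with 1 2 have "d \<le> \<epsilon> * (W + \<Gamma>)" unfolding d_def by (simp add: algebra_simps)
  also have "\<dots> \<le> \<epsilon> * (W + \<bar>\<Gamma>\<bar> + 1)" using \<epsilon> by (intro mult_left_mono) auto
  also have "\<dots> = d / 2"
    using W0 nonzero_mult_divide_mult_cancel_right[of "W + \<bar>\<Gamma>\<bar> + 1" d 2] by (simp add: \<epsilon>_def del: distrib_left_numeral)
  finally show False using d by simp
qed

text \<open>Vanishing passes first from test functions to continuous functions of compact support
  (the extension lemma with \<open>\<Gamma> = 0\<close>), then by dominated convergence to the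
  indicator of \<open>K\<close>.\<close>

lemma L1_loc_integral_compact_zero:
  fixes g :: "real^'n::finite \<Rightarrow> real"
  assumes g: "g \<in> L1_loc" and 0: "\<And>\<phi>. test_function \<phi> \<Longrightarrow> (\<integral>x. g x * \<phi> x \<partial>lebesgue) = 0"
    and K: "compact K"
  shows "(\<integral>x. g x * indicator K x \<partial>lebesgue) = 0"
proof (cases "K = {}")
  \<comment> \<open>The empty set is separated because \<open>infdist\<close> to it is 0 by
    convention, and the cutoffs below would then be constantly 1.\<close>
  case False
  obtain r where r: "r > 0" "\<And>x. x \<in> K \<Longrightarrow> norm x \<le> r"
    using compact_imp_bounded[OF K] unfolding bounded_pos by blast
  \<comment> \<open>Cutoffs decreasing to the indicator of \<open>K\<close>. The factor
    \<open>Suc n\<close> is at least 1 already for \<open>n = 0\<close>, so every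
    \<open>\<psi> n\<close> vanishes at distance 1 from \<open>K\<close>.\<close>
  define \<psi> where "\<psi> = (\<lambda>n x. max 0 (1 - real (Suc n) * infdist x K))"
  have cont: "continuous_on UNIV (\<psi> n)" for n
    unfolding \<psi>_def by (intro continuous_intros)
  have \<psi>0: "\<psi> n x = 0" if "r + 1 \<le> norm x" for n x
  proof -
    have "1 \<le> infdist x K"
      unfolding infdist_def using False r(2) that
      by (auto intro!: cINF_greatest) (smt (verit) dist_norm norm_triangle_ineq2)
    then have "1 * 1 \<le> real (Suc n) * infdist x K" by (intro mult_mono) auto
    then show ?thesis by (simp add: \<psi>_def)
  qed
  have \<psi>1: "\<bar>\<psi> n x\<bar> \<le> 1" for n x by (simp add: \<psi>_def infdist_nonneg)
  have z: "(\<integral>x. g x * \<psi> n x \<partial>lebesgue) = 0" for n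
    using test_function_bound_extends[OF g cont \<psi>0 \<psi>1, where \<Gamma>=0] r(1) 0 by simp
  have "(\<lambda>n. \<integral>x. g x * \<psi> n x \<partial>lebesgue) \<longlonglongrightarrow> (\<integral>x. g x * indicator K x \<partial>lebesgue)"
  proof (rule integral_dominated_convergence[where w="\<lambda>x. indicator (cball 0 (r + 1)) x * \<bar>g x\<bar>"])
    show "(\<lambda>x. g x * indicator K x) \<in> borel_measurable lebesgue"
      using L1_loc_measurable[OF g] K by (intro borel_measurable_times borel_measurable_indicator)
       (auto simp: lmeasurable_compact fmeasurableD)
    show "(\<lambda>x. g x * \<psi> n x) \<in> borel_measurable lebesgue" for n
      using L1_loc_measurable[OF g] continuous_measurable_lebesgue[OF cont] by (rule borel_measurable_times)
    show "integrable lebesgue (\<lambda>x. indicator (cball 0 (r + 1)) x * \<bar>g x\<bar>)"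
      by (rule L1_loc_integrable_cball[OF g])
    show "AE x in lebesgue. norm (g x * \<psi> n x) \<le> indicator (cball 0 (r + 1)) x * \<bar>g x\<bar>" for n
    proof (rule AE_I2)
      fix x
      show "norm (g x * \<psi> n x) \<le> indicator (cball 0 (r + 1)) x * \<bar>g x\<bar>"
        using \<psi>0[of x n] \<psi>1[of n x]
        by (cases "norm x \<le> r + 1") (auto simp: abs_mult mult_left_le)
    qed
    show "AE x in lebesgue. (\<lambda>n. g x * \<psi> n x) \<longlonglongrightarrow> g x * indicator K x"
    proof (intro AE_I2 tendsto_mult tendsto_const)
      fix x
      show "(\<lambda>n. \<psi> n x) \<longlonglongrightarrow> indicator K x"
      proof (cases "x \<in> K")
        case True
        then show ?thesis by (simp add: \<psi>_def)
      next
        case F: False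
        then have "infdist x K > 0"
          using K False compact_imp_closed infdist_pos_not_in_closed by blast
        then obtain N where N: "1 < real N * infdist x K" using ex_less_of_nat_mult by blast
        have "\<psi> n x = 0" if "n \<ge> N" for n
        proof -
          have "real N * infdist x K \<le> real (Suc n) * infdist x K"
            using that by (intro mult_right_mono) (auto simp: infdist_nonneg)
          then show ?thesis using N by (simp add: \<psi>_def)
        qed
        then show ?thesis using F
          by (intro tendsto_eventually) (auto simp: eventually_sequentially)
      qed
    qed
  qed
  then have "(\<lambda>n::nat. 0) \<longlonglongrightarrow> (\<integral>x. g x * indicator K x \<partial>lebesgue)" by (simp only: z)
  then show ?thesis using LIMSEQ_unique tendsto_const by blast
qed simp

text \<open>On a compact subset of \<open>{x. 0 < g x}\<close> the integral of \<open>g\<close>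
  vanishes, which forces the subset to be null; inner regularity then makes the whole set null. The
  opposite inequality comes from exchanging two weak derivatives in the uniqueness proof.\<close>

lemma L1_loc_AE_le_zero:
  fixes g :: "real^'n::finite \<Rightarrow> real"
  assumes g: "g \<in> L1_loc" and 0: "\<And>\<phi>. test_function \<phi> \<Longrightarrow> (\<integral>x. g x * \<phi> x \<partial>lebesgue) = 0"
  shows "AE x in lebesgue. g x \<le> 0"
proof -
  have [measurable]: "g \<in> borel_measurable lebesgue" by (rule L1_loc_measurable[OF g])
  define S where "S = {x. 0 < g x}"
  have S: "S \<in> sets lebesgue"
    using borel_measurable_less[of "\<lambda>_. 0" lebesgue g] by (simp add: S_def)
  have nullK: "emeasure lebesgue K = 0" if K: "compact K" "K \<subseteq> S" for K
  proof -
    have Km: "K \<in> sets lebesgue" using K(1) by (simp add: lmeasurable_compact fmeasurableD)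
    have int: "integrable lebesgue (\<lambda>x. g x * indicator K x)"
    proof -
      have "g absolutely_integrable_on K" using g K(1) by (auto simp: L1_loc_def)
      then show ?thesis unfolding set_integrable_def by (simp add: mult.commute)
    qed
    have "AE x in lebesgue. 0 \<le> g x * indicator K x"
      using K(2) by (intro AE_I2) (auto simp: S_def indicator_def less_imp_le)
    then have "AE x in lebesgue. g x * indicator K x = 0"
      using L1_loc_integral_compact_zero[OF g 0 K(1)] integral_nonneg_eq_0_iff_AE[OF int] by blast
    then have "AE x in lebesgue. x \<notin> K"
      using K(2) by (auto elim!: eventually_mono simp: S_def indicator_def split: if_splits)
    then show ?thesis using Km by (simp add: AE_iff_measurable)
  qed
  have "emeasure lebesgue S \<le> 0 + ennreal e" if "e > 0" for e :: real
  proof -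
    obtain T where T: "closed T" "T \<subseteq> S" "S - T \<in> lmeasurable" "emeasure lebesgue (S - T) < ennreal e"
      using sets_lebesgue_inner_closed[OF S, of e] \<open>e > 0\<close> by metis
    \<comment> \<open>The inner approximation is only closed; cutting with balls writes it as a
      countable union of compact null sets.\<close>
    have "T = (\<Union>n. T \<inter> cball 0 (real n))"
      using real_arch_simple by (auto simp: mem_cball)
    moreover have "(\<Union>n. T \<inter> cball 0 (real n)) \<in> null_sets lebesgue"
    proof (intro null_sets_UN null_setsI)
      fix n
      have "compact (T \<inter> cball 0 (real n))" using T(1) by (simp add: closed_Int_compact)
      then show "emeasure lebesgue (T \<inter> cball 0 (real n)) = 0" "T \<inter> cball 0 (real n) \<in> sets lebesgue"
        using nullK T(2) by (auto simp: lmeasurable_compact fmeasurableD)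
    qed
    ultimately have T0: "T \<in> null_sets lebesgue"
      by (rule ssubst[where P="\<lambda>X. X \<in> null_sets lebesgue"])
    have "emeasure lebesgue S \<le> emeasure lebesgue (T \<union> (S - T))"
      using T S T0 by (intro emeasure_mono) auto
    also have "\<dots> \<le> emeasure lebesgue T + emeasure lebesgue (S - T)"
      using T T0 by (intro emeasure_subadditive) (auto simp: fmeasurableD)
    also have "emeasure lebesgue T = 0" using T0 by (rule null_setsD1)
    finally show ?thesis using T(4) by (meson add_left_mono less_imp_le order_trans)
  qed
  then have "emeasure lebesgue S \<le> 0" by (rule ennreal_le_epsilon)
  then have "AE x in lebesgue. x \<notin> S" using S by (simp add: AE_iff_measurable)
  then show ?thesis by (auto elim!: eventually_mono simp: S_def)
qed

lemma weak_partial_unique: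
  fixes u :: "real^'n::finite \<Rightarrow> real"
  assumes "has_weak_partial i u g" "has_weak_partial i u h"
  shows "AE x in lebesgue. g x = h x"
proof -
  have le: "AE x in lebesgue. g x - h x \<le> 0"
    if "has_weak_partial i u g" "has_weak_partial i u h" for g h
  proof (rule L1_loc_AE_le_zero)
    have L: "g \<in> L1_loc" "h \<in> L1_loc" using that by (auto simp: has_weak_partial_def)
    then show "(\<lambda>x. g x - h x) \<in> L1_loc"
      using L1_loc_add[OF L(1) L1_loc_mult_continuous[OF L(2), of "\<lambda>_. -1"]] by simp
    fix \<phi> :: "real^'n \<Rightarrow> real" assume \<phi>: "test_function \<phi>"
    obtain R where R: "smooth \<phi>" "\<And>x. R \<le> norm x \<Longrightarrow> \<phi> x = 0"
      using test_functionE[OF \<phi>] by blast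
    have "integrable lebesgue (\<lambda>x. g x * \<phi> x)" "integrable lebesgue (\<lambda>x. h x * \<phi> x)"
      using integrable_L1_loc_mult[OF L(1) smooth_continuous[OF R(1)], of R]
        integrable_L1_loc_mult[OF L(2) smooth_continuous[OF R(1)], of R] R(2) by auto
    then show "(\<integral>x. (g x - h x) * \<phi> x \<partial>lebesgue) = 0"
      using that \<phi> unfolding has_weak_partial_def by (simp add: left_diff_distrib)
  qed
  show ?thesis using le[OF assms] le[OF assms(2,1)] by eventually_elim simp
qed

section \<open>Difference quotients of functions with a weak derivative\<close>

definition diff_quot :: "'n::finite \<Rightarrow> real \<Rightarrow> (real^'n \<Rightarrow> real) \<Rightarrow> real^'n \<Rightarrow> real" where
  "diff_quot i h u x = (u (x + h *\<^sub>R axis i 1) - u x) / h"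

lemma continuous_on_shift:
  fixes u :: "'a::real_normed_vector \<Rightarrow> 'b::topological_space"
  assumes "continuous_on UNIV u" shows "continuous_on A (\<lambda>x. u (x + a))"
  by (rule continuous_on_compose2[OF assms]) (auto intro!: continuous_intros)

lemma continuous_on_diff_quot:
  "continuous_on UNIV u \<Longrightarrow> h \<noteq> 0 \<Longrightarrow> continuous_on UNIV (diff_quot i h u)"
  unfolding diff_quot_def by (intro continuous_intros continuous_on_shift) auto

text \<open>Discrete integration by parts: translating by \<open>h\<close> moves the difference
  quotient from \<open>u\<close> to \<open>\<psi>\<close>, with the opposite step.\<close>

lemma integral_diff_quot_shift:
  fixes u \<psi> :: "real^'n::finite \<Rightarrow> real"
  assumes u: "continuous_on UNIV u" and \<psi>: "continuous_on UNIV \<psi>" "\<And>x. R \<le> norm x \<Longrightarrow> \<psi> x = 0"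
  shows "(\<integral>x. diff_quot i h u x * \<psi> x \<partial>lebesgue)
    = - (\<integral>x. u x * diff_quot i (- h) \<psi> x \<partial>lebesgue)"
proof -
  let ?e = "axis i 1 :: real^'n"
  have \<psi>': "\<psi> (x + - h *\<^sub>R ?e) = 0" if "R + \<bar>h\<bar> < norm x" for x
    using that norm_triangle_ineq4[of "x + - h *\<^sub>R ?e" "- h *\<^sub>R ?e"] by (intro \<psi>(2)) simp
  have i1: "integrable lebesgue (\<lambda>x. u (x + h *\<^sub>R ?e) * \<psi> x)"
    by (rule integrable_L1_loc_mult[OF L1_loc_continuous \<psi>(1), of _ R])
      (use u \<psi>(2) in \<open>auto intro: continuous_on_shift\<close>)
  have i2: "integrable lebesgue (\<lambda>x. u x * \<psi> x)"
    by (rule integrable_L1_loc_mult[OF L1_loc_continuous \<psi>(1), of _ R]) (use u \<psi>(2) in auto)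
  have i3: "integrable lebesgue (\<lambda>x. u x * \<psi> (x + - h *\<^sub>R ?e))"
    by (rule integrable_L1_loc_mult[OF L1_loc_continuous[OF u] continuous_on_shift[OF \<psi>(1)] \<psi>'])
  have c: "continuous_on UNIV (\<lambda>x. u x * \<psi> (x + - h *\<^sub>R ?e))"
    by (intro continuous_on_mult u continuous_on_shift[OF \<psi>(1)])
  have "(\<integral>x. diff_quot i h u x * \<psi> x \<partial>lebesgue)
    = (\<integral>x. (u (x + h *\<^sub>R ?e) * \<psi> x - u x * \<psi> x) / h \<partial>lebesgue)"
    by (simp add: diff_quot_def left_diff_distrib)
  also have "\<dots> = ((\<integral>x. u (x + h *\<^sub>R ?e) * \<psi> x \<partial>lebesgue) - (\<integral>x. u x * \<psi> x \<partial>lebesgue)) / h"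
    using i1 i2 by simp
  also have "(\<integral>x. u (x + h *\<^sub>R ?e) * \<psi> x \<partial>lebesgue) = (\<integral>x. u x * \<psi> (x + - h *\<^sub>R ?e) \<partial>lebesgue)"
    using integral_translation_continuous[OF c, of "h *\<^sub>R ?e"] by simp
  also have "((\<integral>x. u x * \<psi> (x + - h *\<^sub>R ?e) \<partial>lebesgue) - (\<integral>x. u x * \<psi> x \<partial>lebesgue)) / h
    = (\<integral>x. (u x * \<psi> (x + - h *\<^sub>R ?e) - u x * \<psi> x) / h \<partial>lebesgue)"
    using i2 i3 by simp
  also have "\<dots> = (\<integral>x. - (u x * diff_quot i (- h) \<psi> x) \<partial>lebesgue)"
    by (simp add: diff_quot_def right_diff_distrib minus_divide_left)
  finally show ?thesis by simp
qed

lemma integral_diff_quot_test_tendsto: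
  fixes u :: "real^'n::finite \<Rightarrow> real"
  assumes u: "continuous_on UNIV u" and \<phi>: "test_function \<phi>"
  shows "((\<lambda>h. \<integral>x. diff_quot i h u x * \<phi> x \<partial>lebesgue)
    \<longlongrightarrow> - (\<integral>x. u x * partial i \<phi> x \<partial>lebesgue)) (at_right 0)"
proof -
  obtain R where R: "smooth \<phi>" "\<And>x. R \<le> norm x \<Longrightarrow> \<phi> x = 0"
    using test_functionE[OF \<phi>] by blast
  have "filterlim (\<lambda>h::real. - h) (at 0) (at_right 0)"
    by (rule filterlim_atI) (auto intro!: tendsto_eq_intros simp: eventually_at_filter)
  from filterlim_compose[OF L1_loc_difference_quotient_tendsto[OF L1_loc_continuous[OF u] \<phi>] this]
  have "((\<lambda>h. \<integral>x. u x * diff_quot i (- h) \<phi> x \<partial>lebesgue) \<longlongrightarrow> (\<integral>x. u x * partial i \<phi> x \<partial>lebesgue)) (at_right 0)"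
    by (simp add: diff_quot_def)
  then show ?thesis
    using integral_diff_quot_shift[OF u smooth_continuous[OF R(1)] R(2)] by (simp add: tendsto_minus)
qed

text \<open>The pairing of \<open>u\<close> with the shifted test function is differentiable in the
  shift, with derivative minus the pairing of \<open>g\<close> with the same shift. The mean value
  theorem for this scalar function takes the place of absolute continuity of \<open>u\<close> on
  lines.\<close>

lemma weak_partial_diff_quot_test:
  fixes u :: "real^'n::finite \<Rightarrow> real"
  assumes wp: "has_weak_partial i u g" and u: "continuous_on UNIV u" and \<phi>: "test_function \<phi>" and "h > 0"
  obtains \<xi> where "- h < \<xi>" "\<xi> < 0"
    "(\<integral>x. diff_quot i h u x * \<phi> x \<partial>lebesgue) = (\<integral>x. g x * \<phi> (x + \<xi> *\<^sub>R axis i 1) \<partial>lebesgue)"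
proof -
  let ?e = "axis i 1 :: real^'n"
  obtain R where R: "smooth \<phi>" "\<And>x. R \<le> norm x \<Longrightarrow> \<phi> x = 0"
    using test_functionE[OF \<phi>] by blast
  have t: "test_function (\<lambda>x. \<phi> (x + s *\<^sub>R ?e))" for s
    using test_function_affine[OF \<phi>, of 1 "s *\<^sub>R ?e"] by simp
  have int: "integrable lebesgue (\<lambda>x. u x * \<phi> (x + s *\<^sub>R ?e))" for s
  proof -
    obtain Q where "smooth (\<lambda>x. \<phi> (x + s *\<^sub>R ?e))" "\<And>x. Q \<le> norm x \<Longrightarrow> \<phi> (x + s *\<^sub>R ?e) = 0"
      using test_functionE[OF t[of s]] by auto
    then show ?thesis
      using integrable_L1_loc_mult[OF L1_loc_continuous[OF u], of "\<lambda>x. \<phi> (x + s *\<^sub>R ?e)" Q]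
        smooth_continuous by auto
  qed
  define I where "I = (\<lambda>s. \<integral>x. u x * \<phi> (x + s *\<^sub>R ?e) \<partial>lebesgue)"
  define I' where "I' = (\<lambda>s. - (\<integral>x. g x * \<phi> (x + s *\<^sub>R ?e) \<partial>lebesgue))"
  have D: "(I has_real_derivative I' s) (at s)" for s
  proof -
    have "((\<lambda>k. \<integral>x. u x * ((\<phi> (x + k *\<^sub>R ?e + s *\<^sub>R ?e) - \<phi> (x + s *\<^sub>R ?e)) / k) \<partial>lebesgue)
       \<longlongrightarrow> (\<integral>x. u x * partial i (\<lambda>x. \<phi> (x + s *\<^sub>R ?e)) x \<partial>lebesgue)) (at 0)"
      by (rule L1_loc_difference_quotient_tendsto[OF L1_loc_continuous[OF u] t])
    moreover have "(\<integral>x. u x * ((\<phi> (x + k *\<^sub>R ?e + s *\<^sub>R ?e) - \<phi> (x + s *\<^sub>R ?e)) / k) \<partial>lebesgue)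
        = (I (s + k) - I s) / k" for k
    proof -
      have "(\<integral>x. u x * ((\<phi> (x + k *\<^sub>R ?e + s *\<^sub>R ?e) - \<phi> (x + s *\<^sub>R ?e)) / k) \<partial>lebesgue)
        = (\<integral>x. (u x * \<phi> (x + (s + k) *\<^sub>R ?e) - u x * \<phi> (x + s *\<^sub>R ?e)) / k \<partial>lebesgue)"
        by (simp add: algebra_simps)
      then show ?thesis using int by (simp add: I_def)
    qed
    moreover have "(\<integral>x. u x * partial i (\<lambda>x. \<phi> (x + s *\<^sub>R ?e)) x \<partial>lebesgue) = I' s"
      using wp t unfolding has_weak_partial_def I'_def by blast
    ultimately show ?thesis unfolding DERIV_def by (simp only:)
  qed
  \<comment> \<open>The interval lies to the left of 0 because moving the quotient onto
    \<open>\<phi>\<close> reverses the step.\<close>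
  obtain \<xi> where \<xi>: "- h < \<xi>" "\<xi> < 0" "I 0 - I (- h) = (0 - (- h)) * I' \<xi>"
    using MVT2[of "- h" 0 I I'] D \<open>h > 0\<close> by auto
  have "(\<integral>x. diff_quot i h u x * \<phi> x \<partial>lebesgue) = - (\<integral>x. (u x * \<phi> (x + - h *\<^sub>R ?e) - u x * \<phi> (x + 0 *\<^sub>R ?e)) / - h \<partial>lebesgue)"
    using integral_diff_quot_shift[OF u smooth_continuous[OF R(1)] R(2), where i=i and h=h]
    by (simp add: diff_quot_def right_diff_distrib)
  also have "\<dots> = (I (- h) - I 0) / h"
  proof -
    have "(\<integral>x. (u x * \<phi> (x + - h *\<^sub>R ?e) - u x * \<phi> (x + 0 *\<^sub>R ?e)) / - h \<partial>lebesgue)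
      = (I (- h) - I 0) / - h"
      unfolding I_def
      by (subst integral_divide_zero, subst Bochner_Integration.integral_diff[OF int int]) (rule refl)
    then show ?thesis by simp
  qed
  also have "\<dots> = - I' \<xi>" using \<xi>(3) \<open>h > 0\<close> by (simp add: field_simps)
  finally show ?thesis using that \<xi> by (simp add: I'_def)
qed

text \<open>The point is uniformity in \<open>h\<close>. For a test function the mean value form
  shifts the support by less than 1, whence the radius \<open>2 * R + 1\<close>; density extends the
  bound to continuous \<open>\<psi>\<close>.\<close>

lemma weak_partial_diff_quot_bound:
  fixes u :: "real^'n::finite \<Rightarrow> real"
  assumes wp: "has_weak_partial i u g" and u: "continuous_on UNIV u" and h: "0 < h" "h \<le> 1"
    and \<psi>: "continuous_on UNIV \<psi>" "\<And>x. R \<le> norm x \<Longrightarrow> \<psi> x = 0" "\<And>x. \<bar>\<psi> x\<bar> \<le> B" and "R > 0"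
  shows "\<bar>\<integral>x. diff_quot i h u x * \<psi> x \<partial>lebesgue\<bar>
    \<le> B * (\<integral>x. indicator (cball 0 (2 * R + 1)) x * \<bar>g x\<bar> \<partial>lebesgue)"
proof (rule test_function_bound_extends[OF _ \<psi> \<open>R > 0\<close>])
  show "diff_quot i h u \<in> L1_loc"
    using h u by (intro L1_loc_continuous continuous_on_diff_quot) auto
  fix q :: "real^'n \<Rightarrow> real" and C assume q: "test_function q" "\<And>x. 2 * R \<le> norm x \<Longrightarrow> q x = 0" "\<And>x. \<bar>q x\<bar> \<le> C"
  have cq: "continuous_on UNIV q" using q(1) smooth_continuous test_functionE by metis
  obtain \<xi> where \<xi>: "- h < \<xi>" "\<xi> < 0"
    "(\<integral>x. diff_quot i h u x * q x \<partial>lebesgue) = (\<integral>x. g x * q (x + \<xi> *\<^sub>R axis i 1) \<partial>lebesgue)"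
    using weak_partial_diff_quot_test[OF wp u q(1) h(1)] by blast
  show "\<bar>\<integral>x. diff_quot i h u x * q x \<partial>lebesgue\<bar>
    \<le> C * (\<integral>x. indicator (cball 0 (2 * R + 1)) x * \<bar>g x\<bar> \<partial>lebesgue)"
    unfolding \<xi>(3)
  proof (rule L1_loc_integral_bound(2)[OF _ _ q(3)])
    show "g \<in> L1_loc" using wp by (simp add: has_weak_partial_def)
    show "(\<lambda>x. q (x + \<xi> *\<^sub>R axis i 1)) \<in> borel_measurable lebesgue"
      by (intro continuous_measurable_lebesgue continuous_on_shift cq)
    show "q (x + \<xi> *\<^sub>R axis i 1) = 0" if "2 * R + 1 < norm x" for x
      using that \<xi>(1,2) h(2) norm_triangle_ineq4[of "x + \<xi> *\<^sub>R axis i 1" "\<xi> *\<^sub>R axis i 1"]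
      by (intro q(2)) simp
  qed
qed

text \<open>Replace \<open>\<psi>\<close> by a test function \<open>q\<close>, for which the limit
  is the definition of the weak derivative. The uniform bound controls the replacement in the
  quotients, simultaneously for all small \<open>h\<close>.\<close>

lemma weak_partial_diff_quot_tendsto:
  fixes u :: "real^'n::finite \<Rightarrow> real"
  assumes wp: "has_weak_partial i u g" and u: "continuous_on UNIV u"
    and \<psi>: "continuous_on UNIV \<psi>" "\<And>x. R \<le> norm x \<Longrightarrow> \<psi> x = 0" and "R > 0"
  shows "((\<lambda>h. \<integral>x. diff_quot i h u x * \<psi> x \<partial>lebesgue) \<longlongrightarrow> (\<integral>x. g x * \<psi> x \<partial>lebesgue)) (at_right 0)"
proof (rule tendstoI)
  fix e :: real assume e: "e > 0"
  have g: "g \<in> L1_loc" using wp by (simp add: has_weak_partial_def)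
  \<comment> \<open>The error \<open>\<psi> - q\<close> is supported in radius \<open>2 * R\<close>,
    so the uniform bound applies with radius \<open>2 * (2 * R) + 1\<close>; the same mass also
    bounds the pairing of the error with \<open>g\<close>. Each of the three errors below is at most
    \<open>e / 4\<close>.\<close>
  define \<Gamma> where "\<Gamma> = (\<integral>x. indicator (cball 0 (2 * (2 * R) + 1)) x * \<bar>g x\<bar> \<partial>lebesgue)"
  have \<Gamma>0: "\<Gamma> \<ge> 0" unfolding \<Gamma>_def by (intro integral_nonneg_AE) auto
  define \<epsilon> where "\<epsilon> = e / (4 * (\<Gamma> + 1))"
  have \<epsilon>: "\<epsilon> > 0" using e \<Gamma>0 by (simp add: \<epsilon>_def)
  have \<epsilon>\<Gamma>: "\<epsilon> * \<Gamma> \<le> e / 4"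
  proof -
    have "\<epsilon> * \<Gamma> \<le> \<epsilon> * (\<Gamma> + 1)" using \<epsilon> by (intro mult_left_mono) auto
    also have "\<dots> = e / 4"
      using \<Gamma>0 nonzero_mult_divide_mult_cancel_right[of "\<Gamma> + 1" e 4] by (simp add: \<epsilon>_def del: distrib_left_numeral)
    finally show ?thesis .
  qed
  obtain q where q: "test_function q" "\<And>x. 2 * R \<le> norm x \<Longrightarrow> q x = 0" "\<And>x. \<bar>\<psi> x - q x\<bar> \<le> \<epsilon>"
    using test_function_approx[OF \<psi>(1) \<open>R > 0\<close> \<psi>(2) \<epsilon>] by blast
  have cq: "continuous_on UNIV q" using q(1) smooth_continuous test_functionE by metis
  have cd: "continuous_on UNIV (\<lambda>x. \<psi> x - q x)" by (intro continuous_intros \<psi>(1) cq)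
  have d0: "\<psi> x - q x = 0" if "2 * R \<le> norm x" for x
    using that q(2)[of x] \<psi>(2)[of x] \<open>R > 0\<close> by simp
  have split: "(\<integral>x. w x * (\<psi> x - q x) \<partial>lebesgue) = (\<integral>x. w x * \<psi> x \<partial>lebesgue) - (\<integral>x. w x * q x \<partial>lebesgue)"
    if "w \<in> L1_loc" for w
  proof -
    have "integrable lebesgue (\<lambda>x. w x * q x)" "integrable lebesgue (\<lambda>x. w x * \<psi> x)"
      using integrable_L1_loc_mult[OF that cq, of "2 * R"] integrable_L1_loc_mult[OF that \<psi>(1), of R] q(2) \<psi>(2)
      by auto
    then show ?thesis by (simp add: right_diff_distrib)
  qed
  have "\<bar>\<integral>x. g x * (\<psi> x - q x) \<partial>lebesgue\<bar> \<le> \<epsilon> * \<Gamma>"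
    unfolding \<Gamma>_def
    by (rule L1_loc_integral_bound(2)[OF g continuous_measurable_lebesgue[OF cd] q(3) d0])
      (use \<open>R > 0\<close> in linarith)
  then have 1: "\<bar>(\<integral>x. g x * \<psi> x \<partial>lebesgue) - (\<integral>x. g x * q x \<partial>lebesgue)\<bar> \<le> e / 4"
    using split[OF g] \<epsilon>\<Gamma> by linarith
  have 2: "\<forall>\<^sub>F h in at_right 0. \<bar>(\<integral>x. diff_quot i h u x * \<psi> x \<partial>lebesgue) - (\<integral>x. diff_quot i h u x * q x \<partial>lebesgue)\<bar> \<le> e / 4"
    unfolding eventually_at_right_field
  proof (intro exI[of _ 1] conjI allI impI)
    fix h :: real assume h: "0 < h" "h < 1"
    have L: "diff_quot i h u \<in> L1_loc"
      using h u by (intro L1_loc_continuous continuous_on_diff_quot) auto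
    have "\<bar>\<integral>x. diff_quot i h u x * (\<psi> x - q x) \<partial>lebesgue\<bar> \<le> \<epsilon> * \<Gamma>"
      unfolding \<Gamma>_def
      by (rule weak_partial_diff_quot_bound[OF wp u _ _ cd d0 q(3)]) (use h \<open>R > 0\<close> in auto)
    then show "\<bar>(\<integral>x. diff_quot i h u x * \<psi> x \<partial>lebesgue) - (\<integral>x. diff_quot i h u x * q x \<partial>lebesgue)\<bar> \<le> e / 4"
      using split[OF L] \<epsilon>\<Gamma> by linarith
  qed simp
  have "((\<lambda>h. \<integral>x. diff_quot i h u x * q x \<partial>lebesgue) \<longlongrightarrow> (\<integral>x. g x * q x \<partial>lebesgue)) (at_right 0)"
    using integral_diff_quot_test_tendsto[OF u q(1), of i] wp q(1) unfolding has_weak_partial_def by simp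
  from tendstoD[OF this, of "e / 4"] e
  have 3: "\<forall>\<^sub>F h in at_right 0. dist (\<integral>x. diff_quot i h u x * q x \<partial>lebesgue) (\<integral>x. g x * q x \<partial>lebesgue) < e / 4"
    by simp
  show "\<forall>\<^sub>F h in at_right 0. dist (\<integral>x. diff_quot i h u x * \<psi> x \<partial>lebesgue) (\<integral>x. g x * \<psi> x \<partial>lebesgue) < e"
    using 2 3
  proof eventually_elim
    case (elim h)
    then show ?case using 1 e unfolding dist_real_def by linarith
  qed
qed

subsection \<open>Chain rule and energy\<close>

text \<open>\<open>Q a b\<close> is the average of \<open>G'\<close> over the segment from
  \<open>a\<close> to \<open>b\<close>. It extends the difference quotient of \<open>G\<close>
  continuously across the diagonal, where division by \<open>b - a\<close> is impossible.\<close>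

lemma mean_slope_exists:
  fixes G G' :: "real \<Rightarrow> real"
  assumes G: "\<And>t. (G has_real_derivative G' t) (at t)"
    and lip: "\<And>s t. \<bar>G' s - G' t\<bar> \<le> L * \<bar>s - t\<bar>"
  obtains Q where "continuous_on UNIV (\<lambda>(a, b). Q a b)"
    "\<And>a b. G b - G a = Q a b * (b - a)" "\<And>a b. \<bar>Q a b - G' a\<bar> \<le> L * \<bar>b - a\<bar>"
proof
  have L0: "L \<ge> 0" using lip[of 1 0] by simp
  have cG': "continuous_on A G'" for A
  proof -
    have "L-lipschitz_on A G'" using L0 lip by (intro lipschitz_onI) (auto simp: dist_real_def)
    then show ?thesis by (rule lipschitz_on_continuous_on)
  qed
  define Q where "Q = (\<lambda>a b. integral {0..1} (\<lambda>\<theta>. G' (a + \<theta> * (b - a))))"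
  have int: "(\<lambda>\<theta>. G' (a + \<theta> * (b - a))) integrable_on {0..1}" for a b
    by (intro integrable_continuous_real continuous_on_compose2[OF cG'[of UNIV]] continuous_intros) auto
  show "continuous_on UNIV (\<lambda>(a, b). Q a b)"
  proof -
    have "continuous_on UNIV (\<lambda>z. integral (cbox 0 1) (\<lambda>\<theta>. G' (fst z + \<theta> * (snd z - fst z))))"
      by (rule integral_continuous_on_param)
        (auto simp: case_prod_unfold intro!: continuous_on_compose2[OF cG'[of UNIV]] continuous_intros)
    then show ?thesis by (simp add: Q_def case_prod_unfold)
  qed
  show "G b - G a = Q a b * (b - a)" for a b
  proof -
    have ftc: "((\<lambda>\<theta>. G' (a + \<theta> * (b - a)) * (b - a)) has_integral
        G (a + 1 * (b - a)) - G (a + 0 * (b - a))) {0..1}"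
      by (intro fundamental_theorem_of_calculus)
        (auto intro!: derivative_eq_intros DERIV_chain2[OF G] simp flip: has_real_derivative_iff_has_vector_derivative)
    have "((\<lambda>\<theta>. G' (a + \<theta> * (b - a)) * (b - a)) has_integral Q a b * (b - a)) {0..1}"
      unfolding Q_def using int by (intro has_integral_mult_left integrable_integral)
    from has_integral_unique[OF this ftc] show ?thesis by simp
  qed
  show "\<bar>Q a b - G' a\<bar> \<le> L * \<bar>b - a\<bar>" for a b
  proof -
    have "Q a b - G' a = integral {0..1} (\<lambda>\<theta>. G' (a + \<theta> * (b - a)) - G' a)"
      unfolding Q_def by (subst Henstock_Kurzweil_Integration.integral_diff[OF int]) auto
    moreover have "norm (integral {0..1} (\<lambda>\<theta>. G' (a + \<theta> * (b - a)) - G' a)) \<le> (L * \<bar>b - a\<bar>) * (1 - 0)"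
    proof (rule integral_bound)
      show "norm (G' (a + \<theta> * (b - a)) - G' a) \<le> L * \<bar>b - a\<bar>" if "\<theta> \<in> {0..1}" for \<theta>
      proof -
        have "norm (G' (a + \<theta> * (b - a)) - G' a) \<le> L * \<bar>\<theta> * (b - a)\<bar>"
          using lip[of "a + \<theta> * (b - a)" a] by simp
        also have "\<dots> \<le> L * (1 * \<bar>b - a\<bar>)"
          unfolding abs_mult using that L0 by (intro mult_left_mono mult_right_mono) auto
        finally show ?thesis by simp
      qed
    qed (auto intro!: continuous_on_compose2[OF cG'[of UNIV]] continuous_intros)
    ultimately show ?thesis by simp
  qed
qed

text \<open>The difference quotient of \<open>G \<circ> u\<close> is that of \<open>u\<close> times
  a mean slope, which is attached to \<open>\<phi>\<close> and gives \<open>\<psi>h\<close>. As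
  \<open>h\<close> tends to 0, \<open>\<psi>h\<close> converges uniformly to
  \<open>\<psi> = G'(u) \<phi>\<close>, and the uniform bound on quotients lets the limit pass
  through.\<close>

lemma has_weak_partial_chain:
  fixes u :: "real^'n::finite \<Rightarrow> real"
  assumes wp: "has_weak_partial i u g" and u: "continuous_on UNIV u"
    and G: "\<And>t. (G has_real_derivative G' t) (at t)"
    and lip: "\<And>s t. \<bar>G' s - G' t\<bar> \<le> L * \<bar>s - t\<bar>"
  shows "has_weak_partial i (\<lambda>x. G (u x)) (\<lambda>x. G' (u x) * g x)"
  unfolding has_weak_partial_def
proof (intro conjI allI impI)
  have L0: "L \<ge> 0" using lip[of 1 0] by simp
  have cG': "continuous_on UNIV G'"
  proof -
    have "L-lipschitz_on UNIV G'" using L0 lip by (intro lipschitz_onI) (auto simp: dist_real_def)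
    then show ?thesis by (rule lipschitz_on_continuous_on)
  qed
  have cG: "continuous_on UNIV G"
    using G by (intro continuous_at_imp_continuous_on) (auto intro: DERIV_isCont)
  have cGu: "continuous_on UNIV (\<lambda>x. G (u x))" "continuous_on UNIV (\<lambda>x. G' (u x))"
    using u by (auto intro: continuous_on_compose2[OF cG] continuous_on_compose2[OF cG'])
  have g: "g \<in> L1_loc" using wp by (simp add: has_weak_partial_def)
  show "(\<lambda>x. G (u x)) \<in> L1_loc" by (rule L1_loc_continuous[OF cGu(1)])
  show "(\<lambda>x. G' (u x) * g x) \<in> L1_loc" by (rule L1_loc_mult_continuous[OF g cGu(2)])
  obtain Q where Q: "continuous_on UNIV (\<lambda>(a, b). Q a b)"
    "\<And>a b. G b - G a = Q a b * (b - a)" "\<And>a b. \<bar>Q a b - G' a\<bar> \<le> L * \<bar>b - a\<bar>"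
    using mean_slope_exists[OF G lip] by blast
  fix \<phi> :: "real^'n \<Rightarrow> real" assume \<phi>: "test_function \<phi>"
  obtain R where R: "R > 0" "smooth \<phi>" "\<And>x. R \<le> norm x \<Longrightarrow> \<phi> x = 0"
    using test_functionE[OF \<phi>] by blast
  have c\<phi>: "continuous_on UNIV \<phi>" by (rule smooth_continuous[OF R(2)])
  obtain C where C: "C > 0" "\<And>x. \<bar>\<phi> x\<bar> \<le> C"
    using continuous_compact_support_bounded[OF c\<phi> R(3)[OF less_imp_le]] by blast
  define \<psi> where "\<psi> = (\<lambda>x. G' (u x) * \<phi> x)"
  define \<psi>h where "\<psi>h = (\<lambda>h x. Q (u x) (u (x + h *\<^sub>R axis i 1)) * \<phi> x)"
  have c\<psi>: "continuous_on UNIV \<psi>" unfolding \<psi>_def by (intro continuous_on_mult cGu c\<phi>)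
  have c\<psi>h: "continuous_on UNIV (\<psi>h h)" for h
  proof -
    have "continuous_on UNIV (\<lambda>x. case (u x, u (x + h *\<^sub>R axis i 1)) of (a, b) \<Rightarrow> Q a b)"
      by (rule continuous_on_compose2[OF Q(1)]) (auto intro!: continuous_on_Pair u continuous_on_shift)
    then show ?thesis unfolding \<psi>h_def by (intro continuous_on_mult c\<phi>) simp
  qed
  have \<psi>0: "\<psi> x = 0" "\<psi>h h x = 0" if "R \<le> norm x" for x h
    using R(3)[OF that] by (auto simp: \<psi>_def \<psi>h_def)
  have eq: "diff_quot i h (\<lambda>x. G (u x)) x * \<phi> x = diff_quot i h u x * \<psi>h h x" for h x
    using Q(2)[of "u (x + h *\<^sub>R axis i 1)" "u x"] by (simp add: diff_quot_def \<psi>h_def mult_ac)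
  define \<Gamma> where "\<Gamma> = (\<integral>x. indicator (cball 0 (2 * R + 1)) x * \<bar>g x\<bar> \<partial>lebesgue)"
  have \<Gamma>0: "\<Gamma> \<ge> 0" unfolding \<Gamma>_def by (intro integral_nonneg_AE) auto
  \<comment> \<open>Radius \<open>R + 1\<close> contains \<open>x\<close> and the shifted point for
    all \<open>x\<close> in the support of \<open>\<phi>\<close> and all
    \<open>h < 1\<close>.\<close>
  have uc: "uniformly_continuous_on (cball 0 (R + 1)) u"
    using u by (intro compact_uniformly_continuous) (auto intro: continuous_on_subset)
  have diff0: "((\<lambda>h. (\<integral>x. diff_quot i h (\<lambda>x. G (u x)) x * \<phi> x \<partial>lebesgue)
      - (\<integral>x. diff_quot i h u x * \<psi> x \<partial>lebesgue)) \<longlongrightarrow> 0) (at_right 0)"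
  proof (rule tendstoI)
    fix e :: real assume e: "e > 0"
    \<comment> \<open>Makes the error \<open>L * \<epsilon> * C * \<Gamma>\<close> at most
      \<open>e / 2\<close>; the summands 1 cover \<open>L = 0\<close> and
      \<open>\<Gamma> = 0\<close>.\<close>
    define \<epsilon> where "\<epsilon> = e / (2 * (L + 1) * C * (\<Gamma> + 1))"
    have \<epsilon>: "\<epsilon> > 0" using e L0 C(1) \<Gamma>0 by (simp add: \<epsilon>_def)
    have \<epsilon>e: "L * \<epsilon> * C * \<Gamma> < e"
    proof -
      have "L * \<epsilon> * C * \<Gamma> \<le> (L + 1) * \<epsilon> * C * (\<Gamma> + 1)"
        using L0 \<epsilon> C(1) \<Gamma>0 by (intro mult_mono) auto
      also have "\<dots> = \<epsilon> * ((L + 1) * C * (\<Gamma> + 1))" by (simp add: mult_ac)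
      also have "\<dots> = e / 2"
      proof -
        have "(L + 1) * C * (\<Gamma> + 1) \<noteq> 0" using L0 C(1) \<Gamma>0 by simp
        then show ?thesis unfolding \<epsilon>_def
          by (simp add: mult.assoc del: distrib_left_numeral distrib_right_numeral)
      qed
      finally show ?thesis using e by simp
    qed
    obtain d where d: "d > 0" "\<And>x y. x \<in> cball 0 (R + 1) \<Longrightarrow> y \<in> cball 0 (R + 1) \<Longrightarrow> dist y x < d \<Longrightarrow> dist (u y) (u x) < \<epsilon>"
      using uc \<epsilon> unfolding uniformly_continuous_on_def by metis
    show "\<forall>\<^sub>F h in at_right 0. dist ((\<integral>x. diff_quot i h (\<lambda>x. G (u x)) x * \<phi> x \<partial>lebesgue)
      - (\<integral>x. diff_quot i h u x * \<psi> x \<partial>lebesgue)) 0 < e"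
      unfolding eventually_at_right_field
    proof (intro exI[of _ "min 1 d"] conjI allI impI)
      fix h :: real assume h: "0 < h" "h < min 1 d"
      have L: "diff_quot i h u \<in> L1_loc"
        using h u by (intro L1_loc_continuous continuous_on_diff_quot) auto
      have small: "\<bar>\<psi>h h x - \<psi> x\<bar> \<le> L * \<epsilon> * C" for x
      proof (cases "R \<le> norm x")
        case True
        then show ?thesis using \<psi>0[OF True] L0 \<epsilon> C(1) by simp
      next
        case False
        have "norm (x + h *\<^sub>R axis i 1) \<le> R + 1"
          using norm_triangle_ineq[of x "h *\<^sub>R axis i 1"] False h by simp
        moreover have "dist (x + h *\<^sub>R axis i 1) x < d" using h by (simp add: dist_norm)
        ultimately have "dist (u (x + h *\<^sub>R axis i 1)) (u x) < \<epsilon>"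
          using False by (intro d(2)) auto
        then have "L * \<bar>u (x + h *\<^sub>R axis i 1) - u x\<bar> \<le> L * \<epsilon>"
          using L0 by (intro mult_left_mono) (auto simp: dist_real_def)
        then have "\<bar>Q (u x) (u (x + h *\<^sub>R axis i 1)) - G' (u x)\<bar> \<le> L * \<epsilon>"
          using Q(3) order_trans by blast
        then have "\<bar>Q (u x) (u (x + h *\<^sub>R axis i 1)) - G' (u x)\<bar> * \<bar>\<phi> x\<bar> \<le> L * \<epsilon> * C"
          using C L0 \<epsilon> by (intro mult_mono) auto
        then show ?thesis by (simp add: \<psi>h_def \<psi>_def abs_mult flip: left_diff_distrib)
      qed
      have "\<bar>\<integral>x. diff_quot i h u x * (\<psi>h h x - \<psi> x) \<partial>lebesgue\<bar> \<le> L * \<epsilon> * C * \<Gamma>"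
        unfolding \<Gamma>_def
        by (rule weak_partial_diff_quot_bound[OF wp u _ _ _ _ small R(1)])
          (use h \<psi>0 c\<psi> c\<psi>h in \<open>auto intro: continuous_on_diff\<close>)
      moreover have "integrable lebesgue (\<lambda>x. diff_quot i h u x * \<psi> x)"
        "integrable lebesgue (\<lambda>x. diff_quot i h u x * \<psi>h h x)"
        using integrable_L1_loc_mult[OF L c\<psi>, of R] integrable_L1_loc_mult[OF L c\<psi>h, of R] \<psi>0 by auto
      ultimately show "dist ((\<integral>x. diff_quot i h (\<lambda>x. G (u x)) x * \<phi> x \<partial>lebesgue)
        - (\<integral>x. diff_quot i h u x * \<psi> x \<partial>lebesgue)) 0 < e"
        using \<epsilon>e by (simp add: eq right_diff_distrib)
    qed (use d(1) in simp)
  qed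
  have "((\<lambda>h. \<integral>x. diff_quot i h (\<lambda>x. G (u x)) x * \<phi> x \<partial>lebesgue) \<longlongrightarrow> 0 + (\<integral>x. g x * \<psi> x \<partial>lebesgue)) (at_right 0)"
    using tendsto_add[OF diff0 weak_partial_diff_quot_tendsto[OF wp u c\<psi> \<psi>0(1) R(1)]] by simp
  then have "- (\<integral>x. G (u x) * partial i \<phi> x \<partial>lebesgue) = 0 + (\<integral>x. g x * \<psi> x \<partial>lebesgue)"
    using integral_diff_quot_test_tendsto[OF cGu(1) \<phi>] tendsto_unique trivial_limit_at_right_real by blast
  then show "(\<integral>x. G (u x) * partial i \<phi> x \<partial>lebesgue) = - (\<integral>x. G' (u x) * g x * \<phi> x \<partial>lebesgue)"
    by (simp add: \<psi>_def mult_ac)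
qed

section \<open>Closure properties of \<open>Lp\<close> and the energy integral\<close>

lemma Lp_mult_bounded:
  assumes f: "f \<in> Lp p" and k: "k \<in> borel_measurable lebesgue" "\<And>x. \<bar>k x\<bar> \<le> B" and "p > 0"
  shows "(\<lambda>x. k x * f x) \<in> Lp p"
proof -
  have fm: "f \<in> borel_measurable lebesgue" and fi: "integrable lebesgue (\<lambda>x. \<bar>f x\<bar> powr p)"
    using f by (auto simp: Lp_def)
  have m: "(\<lambda>x. k x * f x) \<in> borel_measurable lebesgue"
    using k(1) fm by (rule borel_measurable_times)
  have "integrable lebesgue (\<lambda>x. \<bar>k x * f x\<bar> powr p)"
  proof (rule Bochner_Integration.integrable_bound)
    show "integrable lebesgue (\<lambda>x. B powr p * \<bar>f x\<bar> powr p)" using fi by simp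
    show "(\<lambda>x. \<bar>k x * f x\<bar> powr p) \<in> borel_measurable lebesgue" using m by measurable
    show "AE x in lebesgue. norm (\<bar>k x * f x\<bar> powr p) \<le> norm (B powr p * \<bar>f x\<bar> powr p)"
    proof (rule AE_I2)
      fix x
      have "\<bar>k x\<bar> powr p \<le> B powr p" using k(2) \<open>p > 0\<close> by (intro powr_mono2) auto
      then show "norm (\<bar>k x * f x\<bar> powr p) \<le> norm (B powr p * \<bar>f x\<bar> powr p)"
        by (simp add: abs_mult powr_mult mult_right_mono)
    qed
  qed
  then show ?thesis using m by (simp add: Lp_def)
qed

lemma powr_add_le:
  fixes a b p :: real
  assumes "a \<ge> 0" "b \<ge> 0" "p > 0"
  shows "(a + b) powr p \<le> 2 powr p * (a powr p + b powr p)"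
proof -
  have "(a + b) powr p \<le> (2 * max a b) powr p" using assms by (intro powr_mono2) auto
  also have "\<dots> = 2 powr p * max a b powr p" using assms by (simp add: powr_mult)
  also have "\<dots> \<le> 2 powr p * (a powr p + b powr p)"
    by (intro mult_left_mono) (auto simp: max_def)
  finally show ?thesis .
qed

lemma Lp_add:
  assumes f: "f \<in> Lp p" and g: "g \<in> Lp p" and "p > 0"
  shows "(\<lambda>x. f x + g x) \<in> Lp p"
proof -
  have fm: "f \<in> borel_measurable lebesgue" and fi: "integrable lebesgue (\<lambda>x. \<bar>f x\<bar> powr p)"
    using f by (auto simp: Lp_def)
  have gm: "g \<in> borel_measurable lebesgue" and gi: "integrable lebesgue (\<lambda>x. \<bar>g x\<bar> powr p)"
    using g by (auto simp: Lp_def)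
  have m: "(\<lambda>x. f x + g x) \<in> borel_measurable lebesgue"
    using fm gm by (rule borel_measurable_add)
  have "integrable lebesgue (\<lambda>x. \<bar>f x + g x\<bar> powr p)"
  proof (rule Bochner_Integration.integrable_bound)
    show "integrable lebesgue (\<lambda>x. 2 powr p * (\<bar>f x\<bar> powr p + \<bar>g x\<bar> powr p))" using fi gi by simp
    show "(\<lambda>x. \<bar>f x + g x\<bar> powr p) \<in> borel_measurable lebesgue" using m by measurable
    show "AE x in lebesgue. norm (\<bar>f x + g x\<bar> powr p) \<le> norm (2 powr p * (\<bar>f x\<bar> powr p + \<bar>g x\<bar> powr p))"
    proof (rule AE_I2)
      fix x
      have "\<bar>f x + g x\<bar> powr p \<le> (\<bar>f x\<bar> + \<bar>g x\<bar>) powr p" using \<open>p > 0\<close> by (intro powr_mono2) auto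
      also have "\<dots> \<le> 2 powr p * (\<bar>f x\<bar> powr p + \<bar>g x\<bar> powr p)"
        using \<open>p > 0\<close> by (intro powr_add_le) auto
      finally show "norm (\<bar>f x + g x\<bar> powr p) \<le> norm (2 powr p * (\<bar>f x\<bar> powr p + \<bar>g x\<bar> powr p))" by simp
    qed
  qed
  then show ?thesis using m by (simp add: Lp_def)
qed

lemma Lp_compact_support:
  fixes f :: "real^'n::finite \<Rightarrow> real"
  assumes f: "continuous_on UNIV f" "\<And>x. R < norm x \<Longrightarrow> f x = 0" and "p > 0"
  shows "f \<in> Lp p"
proof -
  have m: "f \<in> borel_measurable lebesgue" by (rule continuous_measurable_lebesgue[OF f(1)])
  have c: "continuous_on UNIV (\<lambda>x. \<bar>f x\<bar> powr p)"
    by (rule continuous_on_powr') (use f(1) \<open>p > 0\<close> in \<open>auto intro!: continuous_intros\<close>)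
  have "integrable lebesgue (\<lambda>x. 1 * \<bar>f x\<bar> powr p)"
    by (rule integrable_L1_loc_mult[OF _ c, of _ R]) (use f(2) in \<open>auto intro: L1_loc_continuous\<close>)
  then show ?thesis using m by (simp add: Lp_def)
qed

lemma borel_measurable_norm_vec_powr:
  fixes g :: "'n::finite \<Rightarrow> 'a \<Rightarrow> real"
  assumes [measurable]: "\<And>i. g i \<in> borel_measurable M"
  shows "(\<lambda>x. norm (\<chi> i. g i x) powr p) \<in> borel_measurable M"
  unfolding norm_vec_def L2_set_def by simp

lemma integrable_norm_vec_powr:
  fixes g :: "'n::finite \<Rightarrow> real^'m::finite \<Rightarrow> real"
  assumes g: "\<And>i. g i \<in> Lp p" and "p > 0"
  shows "integrable lebesgue (\<lambda>x. norm (\<chi> i. g i x) powr p)"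
proof (rule Bochner_Integration.integrable_bound)
  show "integrable lebesgue (\<lambda>x. real CARD('n) powr p * (\<Sum>i\<in>UNIV. \<bar>g i x\<bar> powr p))"
    using g by (auto simp: Lp_def)
  show "(\<lambda>x. norm (\<chi> i. g i x) powr p) \<in> borel_measurable lebesgue"
    using g by (intro borel_measurable_norm_vec_powr) (auto simp: Lp_def)
  show "AE x in lebesgue. norm (norm (\<chi> i. g i x) powr p)
    \<le> norm (real CARD('n) powr p * (\<Sum>i\<in>UNIV. \<bar>g i x\<bar> powr p))"
  proof (rule AE_I2)
    fix x
    \<comment> \<open>Dominating the vector norm by its largest component, up to the factor
      \<open>CARD('n)\<close>, allows the power to be taken before summing.\<close>
    define m where "m = Max (range (\<lambda>i. \<bar>g i x\<bar>))"
    have "m \<in> range (\<lambda>i. \<bar>g i x\<bar>)" unfolding m_def by (intro Max_in) auto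
    then obtain j where j: "m = \<bar>g j x\<bar>" by blast
    have "norm (\<chi> i. g i x) \<le> (\<Sum>i\<in>UNIV. \<bar>g i x\<bar>)"
      using norm_le_l1_cart[of "\<chi> i. g i x"] by simp
    also have "\<dots> \<le> (\<Sum>i\<in>(UNIV::'n set). m)"
      by (intro sum_mono) (auto simp: m_def intro!: Max_ge)
    finally have "norm (\<chi> i. g i x) powr p \<le> (real CARD('n) * m) powr p"
      using \<open>p > 0\<close> by (intro powr_mono2) auto
    also have "\<dots> = real CARD('n) powr p * \<bar>g j x\<bar> powr p"
      unfolding j by (rule powr_mult)
    also have "\<dots> \<le> real CARD('n) powr p * (\<Sum>i\<in>UNIV. \<bar>g i x\<bar> powr p)"
      by (intro mult_left_mono member_le_sum) auto
    finally show "norm (norm (\<chi> i. g i x) powr p)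
      \<le> norm (real CARD('n) powr p * (\<Sum>i\<in>UNIV. \<bar>g i x\<bar> powr p))" by simp
  qed
qed

text \<open>The gradient chosen in \<open>energy\<close> agrees almost everywhere with any given
  weak gradient; the exceptional null sets of the finitely many components combine into one.\<close>

lemma energy_eq:
  fixes u :: "real^'n::finite \<Rightarrow> real"
  assumes g: "\<And>i. has_weak_partial i u (g i)"
  shows "energy p u = (\<integral>x. norm (\<chi> i. g i x) powr p \<partial>lebesgue)"
proof -
  have s: "has_weak_partial i u (SOME g. has_weak_partial i u g)" for i
    by (rule someI[of _ "g i"]) (rule g)
  have m: "v \<in> borel_measurable lebesgue" if "has_weak_partial i u v" for v i
    using that L1_loc_measurable by (auto simp: has_weak_partial_def)
  have "AE x in lebesgue. \<forall>i. (SOME g. has_weak_partial i u g) x = g i x"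
    using weak_partial_unique[OF s g] by (simp add: AE_finite_all eventually_all_finite)
  then have "AE x in lebesgue. norm (\<chi> i. (SOME g. has_weak_partial i u g) x) powr p = norm (\<chi> i. g i x) powr p"
    by eventually_elim simp
  then show ?thesis unfolding energy_def weak_gradient_def
    by (intro integral_cong_AE borel_measurable_norm_vec_powr m[OF s] m[OF g])
qed

lemma D1p_E:
  assumes "u \<in> D1p p"
  obtains g where "\<And>i. g i \<in> Lp p" "\<And>i. has_weak_partial i u (g i)"
proof -
  have "\<forall>i. \<exists>g. g \<in> Lp p \<and> has_weak_partial i u g"
    using assms by (auto simp: D1p_def)
  then obtain g where "\<forall>i. g i \<in> Lp p \<and> has_weak_partial i u (g i)" using choice by metis
  then show ?thesis using that by blast
qed

lemma D1p_cont_I: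
  assumes "continuous_on UNIV u" "\<And>i. g i \<in> Lp p" "\<And>i. has_weak_partial i u (g i)"
  shows "u \<in> D1p_cont p"
  using assms L1_loc_continuous unfolding D1p_cont_def D1p_def by blast

lemma D1p_cont_uminus:
  assumes u: "u \<in> D1p_cont p"
  shows "(\<lambda>x. - u x) \<in> D1p_cont p" "energy p (\<lambda>x. - u x) = energy p u"
proof -
  obtain g where g: "\<And>i. g i \<in> Lp p" "\<And>i. has_weak_partial i u (g i)"
    using u D1p_E unfolding D1p_cont_def by blast
  have wp: "has_weak_partial i (\<lambda>x. - u x) (\<lambda>x. - g i x)" for i
    using has_weak_partial_cmult[OF g(2), of i "-1"] by simp
  have "(\<lambda>x. - g i x) \<in> Lp p" for i using g(1)[of i] by (auto simp: Lp_def)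
  then show "(\<lambda>x. - u x) \<in> D1p_cont p"
    using u wp by (intro D1p_cont_I[where g="\<lambda>i x. - g i x"]) (auto simp: D1p_cont_def intro: continuous_on_minus)
  have "norm (\<chi> i. - g i x) = norm (\<chi> i. g i x)" for x
    using norm_minus_cancel[of "\<chi> i. g i x"] by (simp add: vec_eq_iff uminus_vec_def)
  then show "energy p (\<lambda>x. - u x) = energy p u"
    using energy_eq[OF wp] energy_eq[OF g(2)] by simp
qed

subsection \<open>Competitors\<close>

lemma powr_convex_combination:
  fixes a b k p :: real
  assumes "0 \<le> a" "0 \<le> b" "0 \<le> k" "k \<le> 1" "1 \<le> p"
  shows "((1 - k) * a + k * b) powr p \<le> (1 - k) * a powr p + k * b powr p"
proof -
  \<comment> \<open>Handles a vanishing endpoint through \<open>c powr p \<le> c\<close> on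
    \<open>[0, 1]\<close>; convexity of the power is then invoked for positive \<open>a\<close> and
    \<open>b\<close>.\<close>
  have single: "(c * d) powr p \<le> c * d powr p" if "0 \<le> c" "c \<le> 1" "0 \<le> d" for c d
  proof -
    have "c powr p \<le> c powr 1" using that assms(5) by (intro powr_mono') auto
    then show ?thesis using that by (simp add: powr_mult mult_right_mono)
  qed
  consider "a = 0" | "b = 0" | "a > 0" "b > 0" using assms(1,2) by linarith
  then show ?thesis
  proof cases
    case 1
    then show ?thesis using single[of k b] assms by simp
  next
    case 2
    then show ?thesis using single[of "1 - k" a] assms by simp
  next
    case 3
    then show ?thesis
      using convex_onD[OF powr_convex[OF assms(5)], of k a b] assms by simp
  qed
qed

lemma norm_scale_powr_le:
  fixes X :: "'a::real_normed_vector"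
  assumes "0 \<le> k" "k \<le> 1" "1 \<le> p"
  shows "norm ((1 - k) *\<^sub>R X) powr p \<le> (1 - k) * norm X powr p"
  using powr_convex_combination[of "norm X" 0 k p] assms by simp

text \<open>As \<open>k \<ge> 1/2\<close>, the perturbation satisfies
  \<open>norm Y \<le> k * b\<close>, so the sum is bounded by a convex combination of
  \<open>norm X\<close> and \<open>b\<close>. Convexity keeps the coefficient of
  \<open>norm X powr p\<close> at \<open>1 - k\<close>, which a crude bound would spoil.\<close>

lemma norm_add_scaled_powr_le:
  fixes X Y :: "'a::real_normed_vector"
  assumes "1/2 \<le> k" "k \<le> 1" "1 \<le> p" "norm Y \<le> b / 2"
  shows "norm ((1 - k) *\<^sub>R X + Y) powr p \<le> (1 - k) * norm X powr p + b powr p"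
proof -
  have b: "b \<ge> 0" using assms(4) norm_ge_zero[of Y] by linarith
  have "norm ((1 - k) *\<^sub>R X + Y) \<le> (1 - k) * norm X + norm Y"
    using norm_triangle_ineq[of "(1 - k) *\<^sub>R X" Y] assms by simp
  also have "norm Y \<le> k * b" using assms(4) mult_right_mono[OF assms(1) b] by simp
  finally have "norm ((1 - k) *\<^sub>R X + Y) powr p \<le> ((1 - k) * norm X + k * b) powr p"
    using assms(3) by (intro powr_mono2) auto
  also have "\<dots> \<le> (1 - k) * norm X powr p + k * b powr p"
    using assms b by (intro powr_convex_combination) auto
  also have "\<dots> \<le> (1 - k) * norm X powr p + b powr p"
    using assms by (simp add: mult_left_le_one_le)
  finally show ?thesis .
qed

text \<open>Squaring the positive part removes its corner and gives a Lipschitz derivative, as the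
  chain rule demands.\<close>

lemma pos_part_square_deriv:
  "((\<lambda>t. (max 0 t)\<^sup>2 / 2) has_real_derivative max 0 t) (at t)"
proof -
  consider "t > 0" | "t < 0" | "t = 0" by linarith
  then show ?thesis
  proof cases
    case 1
    have "((\<lambda>t. t\<^sup>2 / 2) has_real_derivative max 0 t) (at t)"
      using 1 by (auto intro!: derivative_eq_intros)
    moreover have "\<forall>\<^sub>F s in nhds t. s\<^sup>2 / 2 = (max 0 s)\<^sup>2 / 2"
      using 1 eventually_nhds_in_open[of "{0<..}" t] by (auto elim!: eventually_mono)
    ultimately show ?thesis by (rule DERIV_cong_ev[OF refl _ refl, THEN iffD1, rotated])
  next
    case 2
    have "((\<lambda>t. 0) has_real_derivative max 0 t) (at t)" using 2 by simp
    moreover have "\<forall>\<^sub>F s in nhds t. 0 = (max 0 s)\<^sup>2 / 2"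
      using 2 eventually_nhds_in_open[of "{..<0}" t] by (auto elim!: eventually_mono)
    ultimately show ?thesis by (rule DERIV_cong_ev[OF refl _ refl, THEN iffD1, rotated])
  next
    case 3
    have "((\<lambda>h. (max 0 h)\<^sup>2 / 2 / h) \<longlongrightarrow> 0) (at (0::real))"
    proof (rule Lim_null_comparison)
      show "\<forall>\<^sub>F h::real in at 0. norm ((max 0 h)\<^sup>2 / 2 / h) \<le> \<bar>h\<bar>"
        by (auto simp: eventually_at_filter max_def power2_eq_square)
      show "((\<lambda>h::real. \<bar>h\<bar>) \<longlongrightarrow> 0) (at 0)" by (auto intro!: tendsto_eq_intros)
    qed
    then show ?thesis using 3 by (simp add: DERIV_def)
  qed
qed

lemma partial_const_open:
  assumes "open U" "x \<in> U" "\<And>y. y \<in> U \<Longrightarrow> f y = c"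
  shows "partial i f x = 0"
proof -
  have "partial i f x = partial i (\<lambda>_. c) x" using assms by (intro partial_cong_open) auto
  also have "\<dots> = 0" by (rule partial_eq[where D="\<lambda>x. 0"]) simp
  finally show ?thesis .
qed

text \<open>The cutoff contributes no derivative term: \<open>\<eta>\<close> varies only in the
  shell between \<open>R / 2\<close> and \<open>R\<close>, where \<open>u \<le> M - s\<close> makes
  the truncation 0. The gradient is thus a scalar multiple of that of \<open>u\<close>.\<close>

lemma has_weak_partial_truncation:
  fixes u :: "real^'n::finite \<Rightarrow> real"
  assumes u: "continuous_on UNIV u" and wp: "has_weak_partial i u g"
    and \<eta>: "smooth \<eta>" "\<And>x. dist x z \<le> R / 2 \<Longrightarrow> \<eta> x = 1" "\<And>x. R \<le> dist x z \<Longrightarrow> \<eta> x = 0"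
    and "s > 0" and le: "\<And>x. R / 2 \<le> dist x z \<Longrightarrow> dist x z \<le> R \<Longrightarrow> u x \<le> M - s"
  shows "has_weak_partial i (\<lambda>x. \<eta> x * ((max 0 (u x - (M - s)))\<^sup>2 / (2 * s)))
    (\<lambda>x. \<eta> x * (max 0 (u x - (M - s)) / s) * g x)"
proof -
  define G where "G = (\<lambda>t. (max 0 (t - (M - s)))\<^sup>2 / (2 * s))"
  define G' where "G' = (\<lambda>t. max 0 (t - (M - s)) / s)"
  have G: "(G has_real_derivative G' t) (at t)" for t
  proof -
    have "((\<lambda>t. t - (M - s)) has_real_derivative 1) (at t)"
      by (auto intro!: derivative_eq_intros)
    from DERIV_cdivide[OF DERIV_chain2[OF pos_part_square_deriv this], of s]
    show ?thesis by (simp add: G_def G'_def)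
  qed
  have lip: "\<bar>G' a - G' b\<bar> \<le> 1 / s * \<bar>a - b\<bar>" for a b
  proof -
    have "\<bar>G' a - G' b\<bar> = \<bar>max 0 (a - (M - s)) - max 0 (b - (M - s))\<bar> / s"
      using \<open>s > 0\<close> by (simp add: G'_def flip: diff_divide_distrib)
    also have "\<dots> \<le> \<bar>a - b\<bar> / s" using \<open>s > 0\<close> by (intro divide_right_mono) (auto simp: max_def)
    finally show ?thesis by simp
  qed
  have "has_weak_partial i (\<lambda>x. \<eta> x * G (u x)) (\<lambda>x. \<eta> x * (G' (u x) * g x) + partial i \<eta> x * G (u x))"
    by (intro has_weak_partial_mult_smooth has_weak_partial_chain[OF wp u G lip] \<eta>(1))
  moreover have "partial i \<eta> x * G (u x) = 0" for x
  proof -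
    consider "dist x z < R / 2" | "R < dist x z" | "R / 2 \<le> dist x z" "dist x z \<le> R" by linarith
    then show ?thesis
    proof cases
      case 1
      then have "partial i \<eta> x = 0"
        using \<eta>(2) by (intro partial_const_open[of "ball z (R / 2)" _ _ 1]) (auto simp: dist_commute)
      then show ?thesis by simp
    next
      case 2
      then have "partial i \<eta> x = 0"
        using \<eta>(3) by (intro partial_const_open[of "- cball z R" _ _ 0]) (auto simp: dist_commute)
      then show ?thesis by simp
    next
      case 3
      then show ?thesis using le[OF 3] by (simp add: G_def)
    qed
  qed
  ultimately have "has_weak_partial i (\<lambda>x. \<eta> x * G (u x)) (\<lambda>x. \<eta> x * (G' (u x) * g x))"
    by (simp only: add_0_right)
  then show ?thesis by (simp only: G_def G'_def mult.assoc)
qed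

text \<open>The gradient of \<open>v\<close> is \<open>(1 - t \<kappa>) Du + c D\<zeta>\<close>. It
  lies in \<open>Lp\<close> because \<open>\<kappa>\<close> is bounded and \<open>D\<zeta>\<close>
  is continuous with compact support.\<close>

lemma competitor:
  fixes u w \<kappa> \<zeta> :: "real^'n::finite \<Rightarrow> real" and c t :: real
  assumes u: "continuous_on UNIV u" and gL: "\<And>i. g i \<in> Lp p" and gw: "\<And>i. has_weak_partial i u (g i)"
    and w: "continuous_on UNIV w" "\<And>i. has_weak_partial i w (\<lambda>x. \<kappa> x * g i x)"
    and \<kappa>: "continuous_on UNIV \<kappa>" "\<And>x. \<bar>\<kappa> x\<bar> \<le> B"
    and \<zeta>: "test_function \<zeta>" and p: "p > 0"
  defines "v \<equiv> \<lambda>x. u x + (- t * w x + c * \<zeta> x)"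
    and "H \<equiv> \<lambda>x. norm ((1 - t * \<kappa> x) *\<^sub>R (\<chi> i. g i x) + c *\<^sub>R (\<chi> i. partial i \<zeta> x)) powr p"
  shows "v \<in> D1p_cont p" "energy p v = (\<integral>x. H x \<partial>lebesgue)" "integrable lebesgue H"
proof -
  obtain Q where Q: "smooth \<zeta>" "\<And>x. Q \<le> norm x \<Longrightarrow> \<zeta> x = 0"
    using test_functionE[OF \<zeta>] by blast
  define h where "h = (\<lambda>i x. g i x + (- t * (\<kappa> x * g i x) + c * partial i \<zeta> x))"
  have hw: "has_weak_partial i v (h i)" for i
    unfolding v_def h_def
    by (intro has_weak_partial_add has_weak_partial_cmult gw w has_weak_partial_smooth Q)
  have hL: "h i \<in> Lp p" for i
  proof -
    have 1: "(\<lambda>x. \<kappa> x * g i x) \<in> Lp p"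
      by (rule Lp_mult_bounded[OF gL continuous_measurable_lebesgue[OF \<kappa>(1)] \<kappa>(2) p])
    have 2: "(\<lambda>x. - t * (\<kappa> x * g i x)) \<in> Lp p"
      by (rule Lp_mult_bounded[OF 1, of _ "\<bar>t\<bar>"]) (use p in auto)
    have 3: "(\<lambda>x. c * partial i \<zeta> x) \<in> Lp p"
      by (rule Lp_compact_support[of _ Q])
        (use p partial_zero_outside[of Q \<zeta>, OF Q(2)] in
          \<open>auto intro!: smooth_continuous smooth_mult smooth_const smooth_partial Q\<close>)
    show ?thesis unfolding h_def by (intro Lp_add gL 2 3 p)
  qed
  have cv: "continuous_on UNIV v"
    unfolding v_def by (intro continuous_intros u w smooth_continuous Q)
  show "v \<in> D1p_cont p" by (rule D1p_cont_I[OF cv hL hw])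
  have "(1 - t * \<kappa> x) *\<^sub>R (\<chi> i. g i x) + c *\<^sub>R (\<chi> i. partial i \<zeta> x) = (\<chi> i. h i x)" for x
    by (simp add: vec_eq_iff h_def algebra_simps)
  then have H: "H = (\<lambda>x. norm (\<chi> i. h i x) powr p)" by (simp add: H_def)
  show "energy p v = (\<integral>x. H x \<partial>lebesgue)" unfolding H by (rule energy_eq[OF hw])
  show "integrable lebesgue H" unfolding H by (rule integrable_norm_vec_powr[OF hL p])
qed

section \<open>Cutoffs and scaled bumps\<close>

lemma cutoff_exists:
  fixes z :: "real^'n::finite"
  assumes "R > 0"
  obtains \<eta> where "smooth \<eta>" "\<And>x. 0 \<le> \<eta> x" "\<And>x. \<eta> x \<le> 1"
    "\<And>x. dist x z \<le> R / 2 \<Longrightarrow> \<eta> x = 1" "\<And>x. R \<le> dist x z \<Longrightarrow> \<eta> x = 0"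
proof -
  obtain \<beta> :: "real^'n \<Rightarrow> real" where \<beta>: "smooth \<beta>" "\<And>x. 0 \<le> \<beta> x" "\<And>x. \<beta> x \<le> 1"
    "\<And>x. norm x \<le> 1 \<Longrightarrow> \<beta> x = 1" "\<And>x. norm x \<ge> 2 \<Longrightarrow> \<beta> x = 0"
    using smooth_bump_exists by blast
  define \<eta> where "\<eta> = (\<lambda>x. \<beta> ((2 / R) *\<^sub>R x + (- (2 / R)) *\<^sub>R z))"
  have \<eta>: "\<eta> x = \<beta> ((2 / R) *\<^sub>R (x - z))" for x by (simp add: \<eta>_def scaleR_diff_right)
  have n: "norm ((2 / R) *\<^sub>R (x - z)) = 2 * dist x z / R" for x
    using assms by (simp add: dist_norm)
  show ?thesis
  proof (rule that[of \<eta>])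
    show "smooth \<eta>" unfolding \<eta>_def by (rule smooth_affine[OF \<beta>(1)])
    show "\<eta> x = 1" if "dist x z \<le> R / 2" for x
      unfolding \<eta> by (rule \<beta>(4), unfold n) (use that assms in \<open>simp add: field_simps\<close>)
    show "\<eta> x = 0" if "R \<le> dist x z" for x
      unfolding \<eta> by (rule \<beta>(5), unfold n) (use that assms in \<open>simp add: field_simps\<close>)
  qed (auto simp: \<eta> \<beta>)
qed

text \<open>All bumps are rescalings of one function, so \<open>A\<close> depends neither on the
  centre nor on the radius.\<close>

lemma scaled_bump_exists:
  obtains A where "A > 0"
    "\<And>(z :: real^'n::finite) \<rho>. \<rho> > 0 \<Longrightarrow> \<exists>\<zeta>. test_function \<zeta> \<and> \<zeta> z = 1 \<and> (\<forall>x. \<rho> \<le> dist x z \<longrightarrow> \<zeta> x = 0) \<and>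
      (\<forall>x. \<rho> \<le> dist x z \<longrightarrow> (\<chi> i. partial i \<zeta> x) = 0) \<and> (\<forall>x. norm (\<chi> i. partial i \<zeta> x) \<le> A / \<rho>)"
proof -
  obtain \<beta> :: "real^'n \<Rightarrow> real" where \<beta>: "smooth \<beta>" "\<And>x. 0 \<le> \<beta> x" "\<And>x. \<beta> x \<le> 1"
    "\<And>x. norm x \<le> 1 \<Longrightarrow> \<beta> x = 1" "\<And>x. norm x \<ge> 2 \<Longrightarrow> \<beta> x = 0"
    using smooth_bump_exists by blast
  have t\<beta>: "test_function \<beta>" by (rule test_functionI[OF \<beta>(1,5)])
  obtain C where C: "\<And>i. C i > 0" "\<And>i x. \<bar>partial i \<beta> x\<bar> \<le> C i"
  proof -
    have "\<forall>i. \<exists>C>0. \<forall>x. \<bar>partial i \<beta> x\<bar> \<le> C"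
      using test_function_partial_bounded[OF t\<beta>] by metis
    then show ?thesis using that by (auto dest!: choice)
  qed
  define A where "A = 4 * (\<Sum>i\<in>UNIV. C i)"
  have A: "A > 0" unfolding A_def using C(1) by (auto intro!: mult_pos_pos sum_pos)
  show ?thesis
  proof (rule that[OF A])
    fix z :: "real^'n" and \<rho> :: real assume \<rho>: "\<rho> > 0"
    \<comment> \<open>The scale \<open>4 / \<rho>\<close> confines the support to radius
      \<open>\<rho> / 2\<close>, so that the gradient also vanishes at distance exactly
      \<open>\<rho>\<close>. The same 4 enters \<open>A\<close>.\<close>
    define \<zeta> where "\<zeta> = (\<lambda>x. \<beta> ((4 / \<rho>) *\<^sub>R x + (- (4 / \<rho>)) *\<^sub>R z))"
    have \<zeta>: "\<zeta> x = \<beta> ((4 / \<rho>) *\<^sub>R (x - z))" for x by (simp add: \<zeta>_def scaleR_diff_right)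
    have n: "norm ((4 / \<rho>) *\<^sub>R (x - z)) = 4 * dist x z / \<rho>" for x
      using \<rho> by (simp add: dist_norm)
    have \<zeta>0: "\<zeta> x = 0" if "\<rho> / 2 < dist x z" for x
      unfolding \<zeta> by (rule \<beta>(5), unfold n) (use that \<rho> in \<open>simp add: field_simps\<close>)
    have "test_function \<zeta>" unfolding \<zeta>_def by (rule test_function_affine[OF t\<beta>]) (use \<rho> in simp)
    moreover have "\<zeta> z = 1" unfolding \<zeta> by (rule \<beta>(4)) simp
    moreover have "\<zeta> x = 0" if "\<rho> \<le> dist x z" for x using \<zeta>0[of x] that \<rho> by simp
    moreover have "(\<chi> i. partial i \<zeta> x) = 0" if "\<rho> \<le> dist x z" for x
    proof -
      have "partial i \<zeta> x = 0" for i
        by (rule partial_const_open[of "- cball z (\<rho> / 2)" _ _ 0])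
          (use that \<rho> \<zeta>0 in \<open>auto simp: dist_commute\<close>)
      then show ?thesis by (simp add: vec_eq_iff)
    qed
    moreover have "norm (\<chi> i. partial i \<zeta> x) \<le> A / \<rho>" for x
    proof -
      have "norm (\<chi> i. partial i \<zeta> x) \<le> (\<Sum>i\<in>UNIV. \<bar>partial i \<zeta> x\<bar>)"
        using norm_le_l1_cart[of "\<chi> i. partial i \<zeta> x"] by simp
      also have "\<dots> \<le> (\<Sum>i\<in>UNIV. 4 / \<rho> * C i)"
      proof (rule sum_mono)
        fix i
        have "\<bar>partial i \<zeta> x\<bar> = 4 / \<rho> * \<bar>partial i \<beta> ((4 / \<rho>) *\<^sub>R x + (- (4 / \<rho>)) *\<^sub>R z)\<bar>"
          unfolding \<zeta>_def partial_affine[OF \<beta>(1)] using \<rho> by (simp add: abs_mult)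
        also have "\<dots> \<le> 4 / \<rho> * C i" using \<rho> C(2) by (intro mult_left_mono) auto
        finally show "\<bar>partial i \<zeta> x\<bar> \<le> 4 / \<rho> * C i" .
      qed
      also have "\<dots> = A / \<rho>" unfolding A_def sum_distrib_left[symmetric] by simp
      finally show ?thesis .
    qed
    ultimately show "\<exists>\<zeta>. test_function \<zeta> \<and> \<zeta> z = 1 \<and> (\<forall>x. \<rho> \<le> dist x z \<longrightarrow> \<zeta> x = 0) \<and>
      (\<forall>x. \<rho> \<le> dist x z \<longrightarrow> (\<chi> i. partial i \<zeta> x) = 0) \<and> (\<forall>x. norm (\<chi> i. partial i \<zeta> x) \<le> A / \<rho>)"
      by blast
  qed
qed

lemma integrable_bounded_mult:
  assumes F: "integrable M F" and k: "k \<in> borel_measurable M" "\<And>x. 0 \<le> k x" "\<And>x. k x \<le> (1::real)"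
  shows "integrable M (\<lambda>x. k x * F x)"
proof (rule Bochner_Integration.integrable_bound[OF F])
  show "(\<lambda>x. k x * F x) \<in> borel_measurable M"
    using k(1) F by (auto intro: borel_measurable_times)
  show "AE x in M. norm (k x * F x) \<le> norm (F x)"
    using k(2,3) by (intro AE_I2) (simp add: abs_mult mult_left_le_one_le)
qed

text \<open>Inserting the pointwise bound into the minimality inequality cancels the integral of
  \<open>F\<close>: the energy saved by shrinking the gradient cannot exceed the cost
  \<open>J\<close> of the bump.\<close>

lemma energy_gap:
  fixes F H J k :: "'a \<Rightarrow> real"
  assumes F: "integrable M F" and H: "integrable M H" and J: "integrable M J"
    and k: "k \<in> borel_measurable M" "\<And>x. 0 \<le> k x" "\<And>x. k x \<le> 1"
    and le: "\<And>x. H x \<le> (1 - t * k x) * F x + J x"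
    and min: "(\<integral>x. F x \<partial>M) \<le> (\<integral>x. H x \<partial>M)"
  shows "t * (\<integral>x. k x * F x \<partial>M) \<le> (\<integral>x. J x \<partial>M)"
proof -
  have kF: "integrable M (\<lambda>x. k x * F x)" by (rule integrable_bounded_mult[OF F k])
  have "(\<integral>x. H x \<partial>M) \<le> (\<integral>x. F x - t * (k x * F x) + J x \<partial>M)"
    using F H J kF le by (intro integral_mono) (auto simp: algebra_simps)
  also have "\<dots> = (\<integral>x. F x \<partial>M) - t * (\<integral>x. k x * F x \<partial>M) + (\<integral>x. J x \<partial>M)"
    using F J kF by simp
  finally show ?thesis using min by linarith
qed

section \<open>Contradiction at a differentiable strict maximum\<close>

lemma differentiable_lipschitz_at:
  fixes u :: "'a::real_normed_vector \<Rightarrow> real"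
  assumes "u differentiable (at z)"
  obtains K d where "K > 0" "d > 0" "\<And>x. dist x z < d \<Longrightarrow> \<bar>u x - u z\<bar> \<le> K * dist x z"
proof -
  obtain D where D: "(u has_derivative D) (at z)" using assms unfolding differentiable_def by blast
  obtain B where B: "B > 0" "\<And>h. norm (D h) \<le> norm h * B"
    using bounded_linear.pos_bounded[OF has_derivative_bounded_linear[OF D]] by blast
  obtain d where d: "d > 0" "\<And>x. norm (x - z) < d \<Longrightarrow> norm (u x - u z - D (x - z)) \<le> 1 * norm (x - z)"
    using D unfolding has_derivative_at_alt by (metis zero_less_one)
  have "\<bar>u x - u z\<bar> \<le> (B + 1) * dist x z" if "dist x z < d" for x
    using d(2)[of x] B(2)[of "x - z"] that by (simp add: dist_norm algebra_simps)
  then show ?thesis using that[of "B + 1" d] B(1) d(1) by simp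
qed

text \<open>\<open>P\<close> stands for the other prescribed points. The constraints are expressed
  through the values of \<open>u\<close> itself, so that the lemma applies verbatim to the negated
  function at a minimum.\<close>

lemma strict_max_minimizer_not_differentiable:
  fixes u :: "real^'n::finite \<Rightarrow> real"
  assumes n: "CARD('n) \<ge> 2" and p: "p > 1" and uD: "u \<in> D1p_cont p"
    and P: "finite P" "z \<notin> P"
    and min: "\<And>v. v \<in> D1p_cont p \<Longrightarrow> v z = u z \<Longrightarrow> (\<forall>y\<in>P. v y = u y) \<Longrightarrow> energy p u \<le> energy p v"
    and max: "strict_local_max_at u z"
  shows "\<not> u differentiable (at z)"
proof
  assume "u differentiable (at z)"
  then obtain K d where K: "K > 0" "d > 0" "\<And>x. dist x z < d \<Longrightarrow> \<bar>u x - u z\<bar> \<le> K * dist x z"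
    using differentiable_lipschitz_at by blast
  have u: "continuous_on UNIV u" using uD by (simp add: D1p_cont_def)
  obtain g where gL: "\<And>i. g i \<in> Lp p" and gw: "\<And>i. has_weak_partial i u (g i)"
    using uD D1p_E unfolding D1p_cont_def by blast
  obtain r where r: "r > 0" "\<And>y. 0 < dist y z \<Longrightarrow> dist y z < r \<Longrightarrow> u y < u z"
    using max unfolding strict_local_max_at_def by blast
  obtain e where e: "e > 0" "\<And>y. y \<in> P \<Longrightarrow> e \<le> dist y z"
    using finite_set_avoid[OF P(1), of z] P(2) by (metis dist_commute)
  \<comment> \<open>\<open>R < r\<close> puts the closed ball inside the region of strict
    maximality, and \<open>R \<le> e\<close> keeps every modification away from the other constraint
    points.\<close>
  define R where "R = min (r / 2) e"
  have R: "R > 0" "R < r" "R \<le> e" using r(1) e(1) by (auto simp: R_def)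
  define M where "M = u z"
  have uM: "u x \<le> M" if "dist x z \<le> R" for x
    using r(2)[of x] that R(2) unfolding M_def by (cases "x = z") auto
  \<comment> \<open>Strictness of the maximum enters here: on the compact shell \<open>u\<close>
    attains a largest value, and it lies below \<open>M\<close>. If the shell is empty, any positive
    \<open>s0\<close> will do.\<close>
  obtain s0 where s0: "s0 > 0" "\<And>x. R / 2 \<le> dist x z \<Longrightarrow> dist x z \<le> R \<Longrightarrow> u x \<le> M - s0"
  proof -
    let ?S = "cball z R - ball z (R / 2)"
    show ?thesis
    proof (cases "?S = {}")
      case True
      have "u x \<le> M - 1" if "R / 2 \<le> dist x z" "dist x z \<le> R" for x
      proof -
        have "x \<in> ?S" using that by (simp add: dist_commute)
        then show ?thesis using True by blast
      qed
      then show ?thesis using that[of 1] by simp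
    next
      case False
      have "compact ?S" by (intro compact_diff) auto
      then obtain y where y: "y \<in> ?S" "\<And>x. x \<in> ?S \<Longrightarrow> u x \<le> u y"
        using continuous_attains_sup[of ?S u] False u continuous_on_subset by blast
      have "u y < M" using y(1) r(2)[of y] R unfolding M_def by (cases "y = z") (auto simp: dist_commute)
      then show ?thesis using that[of "M - u y"] y(2) by (auto simp: dist_commute)
    qed
  qed
  obtain \<eta> where \<eta>: "smooth \<eta>" "\<And>x. 0 \<le> \<eta> x" "\<And>x. \<eta> x \<le> 1"
    "\<And>x. dist x z \<le> R / 2 \<Longrightarrow> \<eta> x = 1" "\<And>x. R \<le> dist x z \<Longrightarrow> \<eta> x = 0"
    using cutoff_exists[OF R(1), of z] by blast
  obtain A where A: "A > 0" and bump:
    "\<And>(z :: real^'n) \<rho>. \<rho> > 0 \<Longrightarrow> \<exists>\<zeta>. test_function \<zeta> \<and> \<zeta> z = 1 \<and> (\<forall>x. \<rho> \<le> dist x z \<longrightarrow> \<zeta> x = 0) \<and>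
      (\<forall>x. \<rho> \<le> dist x z \<longrightarrow> (\<chi> i. partial i \<zeta> x) = 0) \<and> (\<forall>x. norm (\<chi> i. partial i \<zeta> x) \<le> A / \<rho>)"
    using scaled_bump_exists by blast
  \<comment> \<open>The truncation of \<open>u\<close> and its slope factor, for every level
    \<open>s\<close>, made global by the cutoff \<open>\<eta>\<close>.\<close>
  define w where "w = (\<lambda>s x. \<eta> x * ((max 0 (u x - (M - s)))\<^sup>2 / (2 * s)))"
  define \<kappa> where "\<kappa> = (\<lambda>s x. \<eta> x * (max 0 (u x - (M - s)) / s))"
  define F where "F = (\<lambda>x. norm (\<chi> i. g i x) powr p)"
  have FI: "integrable lebesgue F"
    unfolding F_def by (rule integrable_norm_vec_powr[OF gL]) (use p in simp)
  have F0: "F x \<ge> 0" for x by (simp add: F_def)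
  have cw: "continuous_on UNIV (w s)" for s
    unfolding w_def divide_inverse by (intro continuous_intros smooth_continuous \<eta>(1) u)
  have c\<kappa>: "continuous_on UNIV (\<kappa> s)" for s
    unfolding \<kappa>_def divide_inverse by (intro continuous_intros smooth_continuous \<eta>(1) u)
  have m\<kappa>: "\<kappa> s \<in> borel_measurable lebesgue" for s by (rule continuous_measurable_lebesgue[OF c\<kappa>])
  have \<kappa>0: "0 \<le> \<kappa> s x" if "s > 0" for s x using that \<eta>(2) by (simp add: \<kappa>_def)
  have \<kappa>1: "\<kappa> s x \<le> 1" if "s > 0" for s x
  proof (cases "dist x z \<le> R")
    case True
    have "max 0 (u x - (M - s)) / s \<le> 1" using uM[OF True] that by simp
    then show ?thesis unfolding \<kappa>_def using \<eta>(2,3) that by (intro mult_le_one) auto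
  next
    case False
    then show ?thesis using \<eta>(5)[of x] by (simp add: \<kappa>_def)
  qed
  have ww: "has_weak_partial i (w s) (\<lambda>x. \<kappa> s x * g i x)" if "0 < s" "s \<le> s0" for s i
    unfolding w_def \<kappa>_def
  proof (rule has_weak_partial_truncation[OF u gw \<eta>(1,4,5) that(1)])
    show "u x \<le> M - s" if "R / 2 \<le> dist x z" "dist x z \<le> R" for x
      using s0(2)[OF that] \<open>s \<le> s0\<close> by simp
  qed
  \<comment> \<open>The comparison common to both choices of \<open>t\<close> and \<open>s\<close>.
    Quantifying over \<open>Y\<close> isolates what is used of the bump inside the ball, namely the
    size of its gradient.\<close>
  have gap: "t * (\<integral>x. \<kappa> s x * F x \<partial>lebesgue) \<le> (\<integral>x. J x \<partial>lebesgue)"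
    if s: "0 < s" "s \<le> s0" and \<rho>: "0 < \<rho>" "\<rho> \<le> R" and t: "0 \<le> t" "t \<le> 1"
      and J: "integrable lebesgue J" "\<And>x. J x \<ge> 0"
      and le: "\<And>x (Y::real^'n). dist x z < \<rho> \<Longrightarrow> norm Y \<le> t * s / 2 * (A / \<rho>) \<Longrightarrow>
        norm ((1 - t * \<kappa> s x) *\<^sub>R (\<chi> i. g i x) + Y) powr p \<le> (1 - t * \<kappa> s x) * F x + J x"
    for t s \<rho> J
  proof -
    obtain \<zeta> where \<zeta>: "test_function \<zeta>" "\<zeta> z = 1" "\<And>x. \<rho> \<le> dist x z \<Longrightarrow> \<zeta> x = 0"
      "\<And>x. \<rho> \<le> dist x z \<Longrightarrow> (\<chi> i. partial i \<zeta> x) = 0" "\<And>x. norm (\<chi> i. partial i \<zeta> x) \<le> A / \<rho>"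
      using bump[OF \<rho>(1), of z] by blast
    define v where "v = (\<lambda>x. u x + (- t * w s x + t * s / 2 * \<zeta> x))"
    define H where "H = (\<lambda>x. norm ((1 - t * \<kappa> s x) *\<^sub>R (\<chi> i. g i x) + (t * s / 2) *\<^sub>R (\<chi> i. partial i \<zeta> x)) powr p)"
    have "\<bar>\<kappa> s x\<bar> \<le> 1" for x using \<kappa>0[OF s(1)] \<kappa>1[OF s(1)] by (simp add: abs_le_iff order_trans[of _ 0])
    note comp = competitor[OF u gL gw cw ww[OF s] c\<kappa> this \<zeta>(1), of "t" "t * s / 2", folded v_def H_def]
    have v: "v \<in> D1p_cont p" "energy p v = (\<integral>x. H x \<partial>lebesgue)" "integrable lebesgue H"
      using comp p by auto
    \<comment> \<open>The truncation has value \<open>s / 2\<close> at \<open>z\<close>, so the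
      coefficient \<open>t * s / 2\<close> of the bump restores the constraint.\<close>
    have "v z = u z"
      using s(1) \<eta>(4)[of z] R(1) \<zeta>(2) by (simp add: v_def w_def M_def power2_eq_square)
    moreover have "\<forall>y\<in>P. v y = u y"
    proof
      fix y assume "y \<in> P"
      then have "R \<le> dist y z" using e(2) R(3) by fastforce
      then show "v y = u y" using \<eta>(5) \<zeta>(3) \<rho>(2) by (simp add: v_def w_def)
    qed
    ultimately have "energy p u \<le> energy p v" using min v(1) by blast
    then have le': "(\<integral>x. F x \<partial>lebesgue) \<le> (\<integral>x. H x \<partial>lebesgue)"
      using energy_eq[OF gw] v(2) by (simp add: F_def)
    show ?thesis
    proof (rule energy_gap[OF FI v(3) J(1) m\<kappa> \<kappa>0[OF s(1)] \<kappa>1[OF s(1)] _ le'])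
      fix x
      show "H x \<le> (1 - t * \<kappa> s x) * F x + J x"
      proof (cases "dist x z < \<rho>")
        case True
        have "norm ((t * s / 2) *\<^sub>R (\<chi> i. partial i \<zeta> x)) \<le> t * s / 2 * (A / \<rho>)"
        proof -
          have "\<bar>t * s / 2\<bar> * norm (\<chi> i. partial i \<zeta> x) \<le> \<bar>t * s / 2\<bar> * (A / \<rho>)"
            by (rule mult_left_mono[OF \<zeta>(5)]) simp
          then show ?thesis using t s by simp
        qed
        then show ?thesis unfolding H_def by (rule le[OF True])
      next
        case False
        \<comment> \<open>Away from the bump the gradient is merely shrunk by
          \<open>1 - t * \<kappa> s x\<close>, which costs nothing.\<close>
        then have "H x = norm ((1 - t * \<kappa> s x) *\<^sub>R (\<chi> i. g i x)) powr p"
          using \<zeta>(4)[of x] by (simp add: H_def)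
        also have "\<dots> \<le> (1 - t * \<kappa> s x) * F x"
          unfolding F_def using t \<kappa>0[OF s(1)] \<kappa>1[OF s(1)] p
          by (intro norm_scale_powr_le) (auto intro: mult_le_one)
        finally show ?thesis using J(2)[of x] by simp
      qed
    qed
  qed
  define V where "V = measure lborel (ball (0::real^'n) 1)"
  have ball_int: "(\<integral>x. indicator (ball z \<rho>) x * c \<partial>lebesgue) = c * (\<rho> ^ CARD('n) * V)"
    and ball_integrable: "integrable lebesgue (\<lambda>x. indicator (ball z \<rho>) x * c)"
    if "\<rho> > 0" for \<rho> c :: real
  proof -
    have fin: "emeasure lebesgue (ball z \<rho>) < \<infinity>" using emeasure_lborel_ball_finite[of z \<rho>] by simp
    show "integrable lebesgue (\<lambda>x. indicator (ball z \<rho>) x * c)" using fin by simp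
    have "measure lebesgue (ball z \<rho>) = \<rho> ^ CARD('n) * V"
      using content_ball_conv_unit_ball[of \<rho> z] that by (simp add: V_def)
    then show "(\<integral>x. indicator (ball z \<rho>) x * c \<partial>lebesgue) = c * (\<rho> ^ CARD('n) * V)"
      using fin by simp
  qed
  \<comment> \<open>The four bounds give, in order: the linear estimate on \<open>u - u z\<close>,
    \<open>\<eta> = 1\<close> on the ball, \<open>2 * K * \<rho> \<le> s0\<close>, and finally
    \<open>t = \<rho> \<le> 1\<close> together with monotonicity of powers of
    \<open>\<rho>\<close>.\<close>
  define \<rho>0 where "\<rho>0 = Min {d / 2, R / 2, s0 / (2 * K), 1}"
  have "\<rho>0 > 0" using K R s0 by (simp add: \<rho>0_def)
  moreover have le: "\<rho>0 \<le> d / 2" "\<rho>0 \<le> R / 2" "\<rho>0 \<le> s0 / (2 * K)" "\<rho>0 \<le> 1"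
    unfolding \<rho>0_def by (auto intro!: Min_le)
  moreover have "\<rho>0 < d" using le(1) K(2) by linarith
  ultimately have \<rho>0: "\<rho>0 > 0" "\<rho>0 < d" "\<rho>0 \<le> R / 2" "\<rho>0 \<le> s0 / (2 * K)" "\<rho>0 \<le> 1"
    by blast+
  \<comment> \<open>For \<open>t = 1\<close> and \<open>s = 2 * K * \<rho>\<close> the bump gradient
    is at most \<open>K * A\<close>, independently of \<open>\<rho>\<close>; the base here is twice
    that, as the convexity estimate asks for \<open>norm Y \<le> b / 2\<close>.\<close>
  define D where "D = (2 * K * A) powr p"
  have near: "(\<integral>x. indicator (ball z \<rho>) x * F x \<partial>lebesgue) \<le> 2 * D * (\<rho> ^ CARD('n) * V)"
    if \<rho>: "0 < \<rho>" "\<rho> \<le> \<rho>0" for \<rho>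
  proof -
    \<comment> \<open>On the ball \<open>u \<ge> M - K * \<rho> = M - s / 2\<close>, so this level
      gives \<open>\<kappa> s x \<ge> 1/2\<close> there, the range in which the convexity estimate
      works.\<close>
    define s where "s = 2 * K * \<rho>"
    have "\<rho> \<le> s0 / (2 * K)" using \<rho> \<rho>0(4) by simp
    then have s: "0 < s" "s \<le> s0" using K(1) \<rho>(1) by (auto simp: s_def field_simps)
    have half: "1 / 2 \<le> \<kappa> s x" if x: "dist x z < \<rho>" for x
    proof -
      have "\<bar>u x - u z\<bar> \<le> K * dist x z" using x \<rho> \<rho>0 by (intro K(3)) simp
      also have "\<dots> \<le> K * \<rho>" using x K(1) by simp
      finally have "s / 2 \<le> max 0 (u x - (M - s))" by (simp add: s_def M_def)
      then have "s / 2 / s \<le> max 0 (u x - (M - s)) / s"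
        by (rule divide_right_mono) (use s(1) in simp)
      moreover have "\<eta> x = 1" using x \<rho> \<rho>0 by (intro \<eta>(4)) simp
      moreover have "s / 2 / s = 1 / 2" using s(1) by simp
      ultimately show ?thesis unfolding \<kappa>_def by (simp only: mult_1)
    qed
    have "1 * (\<integral>x. \<kappa> s x * F x \<partial>lebesgue) \<le> (\<integral>x. indicator (ball z \<rho>) x * D \<partial>lebesgue)"
    proof (rule gap[OF s \<rho>(1)])
      show "\<rho> \<le> R" using \<rho> \<rho>0 R(1) by simp
      show "integrable lebesgue (\<lambda>x. indicator (ball z \<rho>) x * D)" by (rule ball_integrable[OF \<rho>(1)])
      show "0 \<le> indicator (ball z \<rho>) x * D" for x by (simp add: D_def)
      fix x and Y :: "real^'n"
      assume x: "dist x z < \<rho>" and Y: "norm Y \<le> 1 * s / 2 * (A / \<rho>)"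
      have "1 * s / 2 * (A / \<rho>) = 2 * K * A / 2" using \<rho>(1) by (simp add: s_def)
      then have "norm ((1 - \<kappa> s x) *\<^sub>R (\<chi> i. g i x) + Y) powr p \<le> (1 - \<kappa> s x) * F x + D"
        unfolding F_def D_def using Y half[OF x] \<kappa>1[OF s(1)] p
        by (intro norm_add_scaled_powr_le) auto
      then show "norm ((1 - 1 * \<kappa> s x) *\<^sub>R (\<chi> i. g i x) + Y) powr p
        \<le> (1 - 1 * \<kappa> s x) * F x + indicator (ball z \<rho>) x * D"
        using x by (simp add: dist_commute)
    qed auto
    then have 1: "(\<integral>x. \<kappa> s x * F x \<partial>lebesgue) \<le> D * (\<rho> ^ CARD('n) * V)"
      unfolding ball_int[OF \<rho>(1)] by linarith
    have "(\<integral>x. indicator (ball z \<rho>) x * F x \<partial>lebesgue) \<le> (\<integral>x. 2 * (\<kappa> s x * F x) \<partial>lebesgue)"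
    proof (rule integral_mono)
      show "integrable lebesgue (\<lambda>x. indicator (ball z \<rho>) x * F x)"
        using integrable_mult_indicator[OF _ FI, of "ball z \<rho>"] by simp
      show "integrable lebesgue (\<lambda>x. 2 * (\<kappa> s x * F x))"
        using integrable_bounded_mult[OF FI m\<kappa> \<kappa>0[OF s(1)] \<kappa>1[OF s(1)]] by simp
      show "indicator (ball z \<rho>) x * F x \<le> 2 * (\<kappa> s x * F x)" for x
      proof (cases "dist x z < \<rho>")
        case True
        then show ?thesis using mult_right_mono[OF half[OF True] F0[of x]] by (simp add: dist_commute)
      next
        case False
        then show ?thesis using \<kappa>0[OF s(1)] F0 by (simp add: dist_commute)
      qed
    qed
    then show ?thesis using 1 by simp
  qed
  define D' where "D' = 2 powr p * (2 * D + (s0 * A / 2) powr p) * V"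
  have far: "(\<integral>x. \<kappa> s0 x * F x \<partial>lebesgue) \<le> D' * \<rho>" if \<rho>: "0 < \<rho>" "\<rho> \<le> \<rho>0" for \<rho>
  proof -
    define E where "E = (s0 * A / 2) powr p"
    \<comment> \<open>Now \<open>t * \<kappa>\<close> may be small and convexity cannot absorb the
      bump, so the crude bound with factor \<open>2 powr p\<close> is used. Its term
      \<open>F\<close> is affordable because \<open>near\<close> bounds the energy of the ball by a
      multiple of \<open>\<rho> ^ CARD('n)\<close>.\<close>
    define J where "J = (\<lambda>x. 2 powr p * (indicator (ball z \<rho>) x * F x + indicator (ball z \<rho>) x * E))"
    have iF: "integrable lebesgue (\<lambda>x. indicator (ball z \<rho>) x * F x)"
      using integrable_mult_indicator[OF _ FI, of "ball z \<rho>"] by simp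
    have "\<rho> * (\<integral>x. \<kappa> s0 x * F x \<partial>lebesgue) \<le> (\<integral>x. J x \<partial>lebesgue)"
    proof (rule gap[OF s0(1) order_refl \<rho>(1)])
      show "\<rho> \<le> R" "\<rho> \<le> 1" "0 \<le> \<rho>" using \<rho> \<rho>0 R(1) by auto
      show "integrable lebesgue J" unfolding J_def using iF ball_integrable[OF \<rho>(1), of E] by simp
      show "0 \<le> J x" for x using F0 by (simp add: J_def E_def)
      fix x and Y :: "real^'n"
      assume x: "dist x z < \<rho>" and Y: "norm Y \<le> \<rho> * s0 / 2 * (A / \<rho>)"
      \<comment> \<open>Taking \<open>t = \<rho>\<close> cancels the factor
        \<open>1 / \<rho>\<close> in the bump gradient.\<close>
      have Y': "norm Y \<le> s0 * A / 2" using Y \<rho>(1) by (simp add: field_simps)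
      have k: "0 \<le> \<rho> * \<kappa> s0 x" "\<rho> * \<kappa> s0 x \<le> 1"
        using \<kappa>0[OF s0(1), of x] \<kappa>1[OF s0(1), of x] \<rho> \<rho>0(5) by (auto intro: mult_le_one)
      have "norm ((1 - \<rho> * \<kappa> s0 x) *\<^sub>R (\<chi> i. g i x) + Y) \<le> norm (\<chi> i. g i x) + s0 * A / 2"
      proof -
        have "(1 - \<rho> * \<kappa> s0 x) * norm (\<chi> i. g i x) \<le> 1 * norm (\<chi> i. g i x)"
          using k by (intro mult_right_mono) auto
        then show ?thesis
          using norm_triangle_ineq[of "(1 - \<rho> * \<kappa> s0 x) *\<^sub>R (\<chi> i. g i x)" Y] Y' k by simp
      qed
      then have "norm ((1 - \<rho> * \<kappa> s0 x) *\<^sub>R (\<chi> i. g i x) + Y) powr p \<le> (norm (\<chi> i. g i x) + s0 * A / 2) powr p"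
        using p by (intro powr_mono2) auto
      also have "\<dots> \<le> 2 powr p * (F x + E)"
        unfolding F_def E_def using p s0(1) A by (intro powr_add_le) auto
      finally have bound: "norm ((1 - \<rho> * \<kappa> s0 x) *\<^sub>R (\<chi> i. g i x) + Y) powr p \<le> 2 powr p * (F x + E)" .
      show "norm ((1 - \<rho> * \<kappa> s0 x) *\<^sub>R (\<chi> i. g i x) + Y) powr p
        \<le> (1 - \<rho> * \<kappa> s0 x) * F x + J x"
      proof -
        have "0 \<le> (1 - \<rho> * \<kappa> s0 x) * F x" using k(2) F0[of x] by (intro mult_nonneg_nonneg) auto
        moreover have "J x = 2 powr p * (F x + E)" using x by (simp add: J_def dist_commute)
        ultimately show ?thesis using bound by linarith
      qed
    qed
    also have "(\<integral>x. J x \<partial>lebesgue)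
      = 2 powr p * ((\<integral>x. indicator (ball z \<rho>) x * F x \<partial>lebesgue) + E * (\<rho> ^ CARD('n) * V))"
      unfolding J_def using iF ball_integrable[OF \<rho>(1), of E] ball_int[OF \<rho>(1), of E] by simp
    also have "\<dots> \<le> 2 powr p * (2 * D * (\<rho> ^ CARD('n) * V) + E * (\<rho> ^ CARD('n) * V))"
      using near[OF \<rho>] by (intro mult_left_mono) auto
    also have "\<dots> = D' * \<rho> ^ CARD('n)" by (simp add: D'_def E_def algebra_simps)
    \<comment> \<open>The dimension hypothesis is used here: one factor \<open>\<rho>\<close> is
      then cancelled against the left side and another remains to tend to 0.\<close>
    also have "\<dots> \<le> D' * \<rho>\<^sup>2"
    proof (rule mult_left_mono)
      show "\<rho> ^ CARD('n) \<le> \<rho>\<^sup>2" using n \<rho> \<rho>0(5) by (intro power_decreasing) auto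
      show "0 \<le> D'" by (auto simp: D'_def D_def V_def)
    qed
    finally have "\<rho> * (\<integral>x. \<kappa> s0 x * F x \<partial>lebesgue) \<le> \<rho> * (D' * \<rho>)"
      by (simp add: power2_eq_square mult_ac)
    then show ?thesis using \<rho>(1) by simp
  qed
  have \<kappa>F: "integrable lebesgue (\<lambda>x. \<kappa> s0 x * F x)"
    by (rule integrable_bounded_mult[OF FI m\<kappa> \<kappa>0[OF s0(1)] \<kappa>1[OF s0(1)]])
  have \<kappa>F0: "AE x in lebesgue. 0 \<le> \<kappa> s0 x * F x" using \<kappa>0[OF s0(1)] F0 by auto
  \<comment> \<open>The integrand is independent of \<open>\<rho>\<close>, so the vanishing upper
    bound forces the integral to be 0.\<close>
  have "(\<integral>x. \<kappa> s0 x * F x \<partial>lebesgue) \<le> 0"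
  proof (rule tendsto_lowerbound)
    show "((\<lambda>\<rho>. D' * \<rho>) \<longlongrightarrow> 0) (at_right 0)" by (auto intro!: tendsto_eq_intros)
    show "\<forall>\<^sub>F \<rho> in at_right 0. (\<integral>x. \<kappa> s0 x * F x \<partial>lebesgue) \<le> D' * \<rho>"
      unfolding eventually_at_right_field using far \<rho>0(1) by (intro exI[of _ \<rho>0]) auto
  qed simp
  then have "(\<integral>x. \<kappa> s0 x * F x \<partial>lebesgue) = 0"
    using integral_nonneg_AE[OF \<kappa>F0] by linarith
  then have AE0: "AE x in lebesgue. \<kappa> s0 x * F x = 0"
    using integral_nonneg_eq_0_iff_AE[OF \<kappa>F \<kappa>F0] by blast
  obtain i :: 'n where True by blast
  have \<kappa>g: "AE x in lebesgue. \<kappa> s0 x * g i x = 0"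
    using AE0
  proof eventually_elim
    case (elim x)
    then have "\<kappa> s0 x = 0 \<or> (\<chi> i. g i x) = 0" by (simp add: F_def)
    then show ?case by (auto simp: vec_eq_iff)
  qed
  have "2 * R > 0" using R(1) by simp
  then obtain b where b: "smooth b" "\<And>x. 0 \<le> b x" "\<And>x. b x \<le> 1"
    "\<And>x. dist x z \<le> 2 * R / 2 \<Longrightarrow> b x = 1" "\<And>x. 2 * R \<le> dist x z \<Longrightarrow> b x = 0"
    using cutoff_exists[of "2 * R" z] by blast
  \<comment> \<open>A test function whose \<open>i\<close>-th derivative is 1 wherever
    \<open>w s0\<close> is nonzero. Testing the vanishing weak derivative of \<open>w s0\<close>
    against it gives \<open>w s0\<close> integral 0. The cutoff uses \<open>2 * R\<close> since it
    equals 1 on half its radius.\<close>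
  define \<phi> where "\<phi> = (\<lambda>x. x $ i * b x)"
  have \<phi>: "test_function \<phi>"
  proof (rule test_functionI)
    show "smooth \<phi>" unfolding \<phi>_def by (intro smooth_mult smooth_coord b(1))
    show "\<phi> x = 0" if "norm z + 2 * R \<le> norm x" for x
      using that b(5)[of x] norm_triangle_ineq2[of x z] by (simp add: \<phi>_def dist_norm)
  qed
  have w\<phi>: "w s0 x * partial i \<phi> x = w s0 x" for x
  proof (cases "dist x z < R")
    case True
    have "partial i \<phi> x = partial i (\<lambda>x. x $ i) x"
      using True b(4) by (intro partial_cong_open[of "ball z R"]) (auto simp: \<phi>_def dist_commute)
    also have "\<dots> = axis i 1 $ i"
      by (rule partial_eq[where D="\<lambda>h. h $ i"])
        (rule bounded_linear_imp_has_derivative[OF bounded_linear_vec_nth])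
    finally show ?thesis by simp
  next
    case False
    then show ?thesis using \<eta>(5)[of x] by (simp add: w_def)
  qed
  have "(\<integral>x. w s0 x * partial i \<phi> x \<partial>lebesgue) = - (\<integral>x. \<kappa> s0 x * g i x * \<phi> x \<partial>lebesgue)"
    using ww[OF s0(1) order_refl, of i] \<phi> unfolding has_weak_partial_def by blast
  also have "(\<integral>x. \<kappa> s0 x * g i x * \<phi> x \<partial>lebesgue) = 0"
    by (rule integral_eq_zero_AE) (use \<kappa>g in eventually_elim, simp)
  finally have w_int: "(\<integral>x. w s0 x \<partial>lebesgue) = 0" by (simp only: w\<phi> minus_zero)
  have w_nonneg: "w s0 x \<ge> 0" for x using \<eta>(2) s0(1) by (simp add: w_def)
  have wI: "integrable lebesgue (w s0)"
  proof -
    have "w s0 x = 0" if "norm z + R < norm x" for x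
      using that \<eta>(5)[of x] norm_triangle_ineq2[of x z] by (simp add: w_def dist_norm)
    then show ?thesis
      using integrable_L1_loc_mult[of "\<lambda>_. 1" "w s0" "norm z + R"] cw by (simp add: L1_loc_continuous)
  qed
  have AEw: "AE x in lebesgue. w s0 x = 0"
    using integral_nonneg_eq_0_iff_AE[OF wI] w_nonneg w_int by simp
  \<comment> \<open>The value is \<open>s0 / 2\<close>; by continuity \<open>w s0\<close> is nonzero
    on a ball of positive measure, although it vanishes almost everywhere.\<close>
  have "w s0 z > 0"
    using s0(1) \<eta>(4)[of z] R(1) by (simp add: w_def M_def)
  moreover have "isCont (w s0) z" using cw continuous_on_eq_continuous_at open_UNIV by blast
  ultimately obtain \<delta> where \<delta>: "\<delta> > 0" "\<And>x. dist z x < \<delta> \<Longrightarrow> w s0 x \<noteq> 0"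
    using continuous_at_avoid[of z "w s0" 0] by auto
  have "AE x in lebesgue. x \<notin> ball z \<delta>"
    using AEw by eventually_elim (use \<delta>(2) in auto)
  then have "emeasure lebesgue (ball z \<delta>) = 0"
    using AE_iff_measurable[of "ball z \<delta>" lebesgue "\<lambda>x. x \<notin> ball z \<delta>"]
    by (simp del: emeasure_completion mem_ball)
  then show False using content_ball_pos[OF \<delta>(1), of z] by (simp add: measure_def)
qed

theorem proposition5p8:
  fixes p :: real and N :: nat
    and x :: "nat \<Rightarrow> real^'n::finite" and a :: "nat \<Rightarrow> real"
    and u :: "real^'n \<Rightarrow> real" and i :: nat
  assumes "CARD('n) \<ge> 2" and "p > real CARD('n)"
    and "inj_on x {1..N}"
    and "u \<in> D1p_cont p" and "\<forall>j\<in>{1..N}. u (x j) = a j"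
    and "\<forall>v\<in>D1p_cont p. (\<forall>j\<in>{1..N}. v (x j) = a j) \<longrightarrow> energy p u \<le> energy p v"
    and "i \<in> {1..N}"
    and "strict_local_max_at u (x i) \<or> strict_local_min_at u (x i)"
  shows "\<not> u differentiable (at (x i))"
proof -
  \<comment> \<open>Injectivity of \<open>x\<close> keeps \<open>x i\<close> out of the set of the
    other prescribed points.\<close>
  define P where "P = x ` ({1..N} - {i})"
  have P: "finite P" "x i \<notin> P" using inj_on_image_mem_iff[OF assms(3,7), of "{1..N} - {i}"] by (simp_all add: P_def)
  have p: "p > 1" using assms(1,2) by linarith
  have same: "v (x j) = u (x j)"
    if "v (x i) = u (x i)" "\<forall>y\<in>P. v y = u y" "j \<in> {1..N}" for v :: "real^'n \<Rightarrow> real" and j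
    using that by (cases "j = i") (auto simp: P_def)
  from assms(8) show ?thesis
  proof
    assume max: "strict_local_max_at u (x i)"
    show ?thesis
    proof (rule strict_max_minimizer_not_differentiable[OF assms(1) p assms(4) P _ max])
      show "energy p u \<le> energy p v"
        if "v \<in> D1p_cont p" "v (x i) = u (x i)" "\<forall>y\<in>P. v y = u y" for v
        using assms(5,6) same[OF that(2,3)] that(1) by simp
    qed
  next
    assume "strict_local_min_at u (x i)"
    \<comment> \<open>Negation turns the minimum into a maximum and preserves the energy; the
      competitors of the negated function are the negatives of those of \<open>u\<close>.\<close>
    then have max: "strict_local_max_at (\<lambda>y. - u y) (x i)"
      by (simp add: strict_local_min_at_def strict_local_max_at_def)
    have "\<not> (\<lambda>y. - u y) differentiable (at (x i))"
    proof (rule strict_max_minimizer_not_differentiable[OF assms(1) p D1p_cont_uminus(1)[OF assms(4)] P _ max])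
      fix v assume v: "v \<in> D1p_cont p" "v (x i) = - u (x i)" "\<forall>y\<in>P. v y = - u y"
      have "energy p u \<le> energy p (\<lambda>y. - v y)"
        using assms(5,6) same[of "\<lambda>y. - v y"] v D1p_cont_uminus(1)[OF v(1)] by simp
      then show "energy p (\<lambda>y. - u y) \<le> energy p v"
        using D1p_cont_uminus(2)[OF v(1)] D1p_cont_uminus(2)[OF assms(4)] by simp
    qed
    then show ?thesis by (auto intro: differentiable_minus)
  qed
qed


end
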